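(* Let $\epsilon_n\to0^+$, let $u_n$ be solutions of $$-\epsilon_n(\phi_p(\epsilon_n u'))'+a(x)W'(u)=0\ \text{ on }[0,1],\qquad u'(0)=0=u'(1),$$ and suppose that their energies $$E_n(x)=-\frac{1}{a(x)}\mathcal L(\epsilon_n u_n'(x))+W(u_n(x)),\qquad x\in[0,1],$$ converge uniformly on $[0,1]$ to a function $E$. Then $E$ satisfies the differential equation $$E'(x)=\frac{a'(x)}{a(x)}\,K(E(x)),\qquad x\in[0,1].$$
   Context: Fix $p>1$, $\phi_p(s)=|s|^{p-2}s$ (with $\phi_p(0)=0$), $p^*=p/(p-1)$, $\mathcal L(s)=\frac{1}{p^*}|s|^p$. The weight $a\in C^1([0,1])$ satisfies $a(x)>0$ for all $x\in[0,1]$. The potential $W:[-1,1]\to\mathbb R$ is of class $C^1$ and satisfies: (W1) there are constants $C_{-1},C_0,C_1,W_0>0$ with $W(u)=\frac{C_{\pm1}}{p}|u-(\pm1)|^p+o(|u-(\pm1)|^p)$ as $u\to\pm1$, and $W(u)=W_0-\frac{C_0}{p}|u|^p+o(|u|^p)$ as $u\to0$; (W2) the function $u\mapsto W'(u)/\phi_p(u)$ on $[-1,1]\setminus\{0\}$ is strictly decreasing on $[-1,0)$ and strictly increasing on $(0,1]$. A solution of the boundary value problem is a function $u\in C^1([0,1])$ with values in $[-1,1]$, with $u'(0)=u'(1)=0$, such that $\phi_p(u')\in C^1([0,1])$ and the equation holds for every $x\in[0,1]$. Definition of $K$: for $\xi\in(0,W_0)$ let $\bar v_{\xi}$ be the unique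 (periodic) solution of $-(\phi_p(v'))'+W'(v)=0$ on $\mathbb R$ with conserved energy $-\mathcal L(v')+W(v)\equiv\xi$, $\bar v_\xi(0)=0$ and $\bar v_\xi'(0)>0$; let $T(\xi)$ be its minimal period, and set $K(\xi)=\frac{1}{T(\xi)}\int_0^{T(\xi)}\mathcal L(\bar v_\xi'(y))\,dy$. $K$ is extended by continuity to $[0,W_0]$ by $K(0)=K(W_0)=0$. (The limit $E$ takes values in $[0,W_0]$.) *)

theory Defs
  imports "HOL-Analysis.Analysis" "HOL-Library.Landau_Symbols"
begin

definition phi :: "real \<Rightarrow> real \<Rightarrow> real" where
  "phi p s = \<bar>s\<bar> powr (p - 2) * s"

definition conj_exp :: "real \<Rightarrow> real" where
  "conj_exp p = p / (p - 1)"

definition kin :: "real \<Rightarrow> real \<Rightarrow> real" where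
  "kin p s = 1 / conj_exp p * \<bar>s\<bar> powr p"

text \<open>Derivative relative to \<open>S\<close>: one-sided at the endpoints of a closed interval, so
  that the values of a function outside its mathematical domain never matter. The library's
  \<open>C1_differentiable_on\<close> uses two-sided derivatives and is therefore not \<open>C\<^sup>1([a,b])\<close>.\<close>

definition deriv_on :: "real set \<Rightarrow> (real \<Rightarrow> real) \<Rightarrow> real \<Rightarrow> real" where
  "deriv_on S f x = vector_derivative f (at x within S)"

definition C1_on :: "real set \<Rightarrow> (real \<Rightarrow> real) \<Rightarrow> bool" where
  "C1_on S f \<longleftrightarrow> f differentiable_on S \<and> continuous_on S (deriv_on S f)"

definition bvp_solution ::
  "real \<Rightarrow> (real \<Rightarrow> real) \<Rightarrow> (real \<Rightarrow> real) \<Rightarrow> real \<Rightarrow> (real \<Rightarrow> real) \<Rightarrow> bool" where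
  "bvp_solution p a W \<epsilon> u \<longleftrightarrow>
     C1_on {0..1} u \<and> u ` {0..1} \<subseteq> {-1..1} \<and>
     deriv_on {0..1} u 0 = 0 \<and> deriv_on {0..1} u 1 = 0 \<and>
     C1_on {0..1} (\<lambda>x. phi p (deriv_on {0..1} u x)) \<and>
     (\<forall>x\<in>{0..1}.
        - (\<epsilon> * deriv_on {0..1} (\<lambda>y. phi p (\<epsilon> * deriv_on {0..1} u y)) x)
        + a x * deriv_on {-1..1} W (u x) = 0)"

definition energy ::
  "real \<Rightarrow> (real \<Rightarrow> real) \<Rightarrow> (real \<Rightarrow> real) \<Rightarrow> real \<Rightarrow> (real \<Rightarrow> real) \<Rightarrow> real \<Rightarrow> real" where
  "energy p a W \<epsilon> u x =
     - (1 / a x) * kin p (\<epsilon> * deriv_on {0..1} u x) + W (u x)"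

definition autonomous_solution ::
  "real \<Rightarrow> (real \<Rightarrow> real) \<Rightarrow> real \<Rightarrow> (real \<Rightarrow> real) \<Rightarrow> bool" where
  "autonomous_solution p W \<xi> v \<longleftrightarrow>
     C1_on UNIV v \<and> range v \<subseteq> {-1..1} \<and>
     C1_on UNIV (\<lambda>y. phi p (deriv_on UNIV v y)) \<and>
     (\<forall>y. - deriv_on UNIV (\<lambda>z. phi p (deriv_on UNIV v z)) y
            + deriv_on {-1..1} W (v y) = 0) \<and>
     (\<forall>y. - kin p (deriv_on UNIV v y) + W (v y) = \<xi>) \<and>
     v 0 = 0 \<and> deriv_on UNIV v 0 > 0"

definition vbar :: "real \<Rightarrow> (real \<Rightarrow> real) \<Rightarrow> real \<Rightarrow> real \<Rightarrow> real" where
  "vbar p W \<xi> = (THE v. autonomous_solution p W \<xi> v)"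

definition min_period :: "(real \<Rightarrow> real) \<Rightarrow> real" where
  "min_period v = (LEAST T. T > 0 \<and> (\<forall>y. v (y + T) = v y))"

text \<open>\<open>K\<close> lives on \<open>[0,W0]\<close> and vanishes at both endpoints; the value \<open>0\<close> outside
  \<open>[0,W0]\<close> is a dummy.\<close>

definition K :: "real \<Rightarrow> (real \<Rightarrow> real) \<Rightarrow> real \<Rightarrow> real \<Rightarrow> real" where
  "K p W W0 \<xi> =
     (if 0 < \<xi> \<and> \<xi> < W0
      then let v = vbar p W \<xi>; T = min_period v
           in 1 / T * integral {0..T} (\<lambda>y. kin p (deriv_on UNIV v y))
      else 0)"

end

theory Submission
  imports Defs "HOL-Complex_Analysis.Great_Picard"
begin

text \<open>
  Differentiating the energy along a solution, the terms of order \<open>1 / \<epsilon>\<close> cancel and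
  \<open>E\<^sub>n' = (a' / a) (W(u\<^sub>n) - E\<^sub>n)\<close> remains, where \<open>W(u\<^sub>n) - E\<^sub>n\<close> is the kinetic energy divided
  by \<open>a\<close> (\<open>energy_deriv\<close>). So the \<open>E\<^sub>n\<close> vary slowly although the \<open>u\<^sub>n\<close> oscillate on the scale
  \<open>\<epsilon>\<^sub>n\<close>, and the limit equation says that this kinetic energy may be replaced by its average over
  one period of the autonomous equation with the frozen energy \<open>E(x)\<close>.

  The averaging is reduced to windows of length \<open>\<epsilon>\<^sub>n s M\<close>, where \<open>s = a(x\<^sub>0)\<^sup>-\<^sup>1\<^sup>/\<^sup>p\<close> and
  \<open>M\<close> is fixed. Magnified by \<open>1 / (\<epsilon>\<^sub>n s)\<close>, the solutions in windows that approach \<open>x\<^sub>0\<close> are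
  uniformly Lipschitz together with their momenta, so a subsequence converges to an orbit on the whole line
  of the autonomous equation with energy \<open>E(x\<^sub>0)\<close> (\<open>ex_blowup_limit\<close>). It therefore suffices that
  for every energy \<open>\<xi>\<close> the averages over \<open>[0, M]\<close> of the kinetic energy of all orbits of energy
  \<open>\<xi>\<close> are uniformly close to \<open>K(\<xi>)\<close> when \<open>M\<close> is chosen suitably (\<open>orbit_average\<close>):

  \<^item> For \<open>0 < \<xi> < W\<^sub>0\<close> initial value problems have unique solutions (\<open>orbit_unique\<close>) although the
    equation need not be Lipschitz, because near each point either the position or the momentum
    solves a scalar autonomous equation with non-vanishing right-hand side. Every orbit crosses
    \<open>0\<close> upwards again and again; so it is a translate of \<open>vbar\<close>, is periodic, and its averages
    differ from \<open>K(\<xi>)\<close> by \<open>O(1 / M)\<close>.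
  \<^item> For \<open>\<xi> = 0\<close> an orbit is constant or monotone, so its total kinetic action is bounded and the
    averages tend to \<open>0\<close>.
  \<^item> For \<open>\<xi> = W\<^sub>0\<close> there is no kinetic energy at all. Other energies admit no orbit, which is why
    \<open>E\<close> takes its values in \<open>[0, W\<^sub>0]\<close>.

  By compactness and contradiction the increments of \<open>E\<^sub>n\<close> over all such windows near \<open>x\<^sub>0\<close> are then
  close to the predicted ones (\<open>window_increment\<close>). Tiling a short interval by windows and letting
  \<open>n\<close> tend to infinity gives the derivative of \<open>E\<close> at \<open>x\<^sub>0\<close>. The existence of \<open>vbar\<close> is a by-product:
  the orbit is supplied by the blow-up.
\<close>

section \<open>The power nonlinearity and its conjugate\<close>

lemma phi_sgn: "phi p s = sgn s * \<bar>s\<bar> powr (p - 1)"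
proof (cases "s = 0")
  case False
  have "\<bar>s\<bar> powr (p - 1) = \<bar>s\<bar> powr (p - 2) * \<bar>s\<bar>"
    using False powr_add[of "\<bar>s\<bar>" "p - 2" 1] by simp
  then show ?thesis
    by (simp add: phi_def) (metis mult.commute mult.left_commute sgn_mult_abs)
qed (simp add: phi_def)

lemma abs_phi: "\<bar>phi p s\<bar> = \<bar>s\<bar> powr (p - 1)"
  by (cases "s = 0") (simp_all add: phi_sgn abs_mult)

lemma sgn_phi [simp]: "sgn (phi p s) = sgn s"
  by (cases "s = 0") (simp_all add: phi_sgn sgn_mult)

lemma phi_minus [simp]: "phi p (- s) = - phi p s"
  by (simp add: phi_def)

lemma phi_eq_0_iff [simp]: "phi p s = 0 \<longleftrightarrow> s = 0"
  by (metis sgn_phi sgn_0_0)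

lemma phi_0 [simp]: "phi p 0 = 0"
  by (simp add: phi_def)

lemma phi_pos_iff [simp]: "phi p s > 0 \<longleftrightarrow> s > 0"
  by (metis sgn_phi sgn_greater)

lemma phi_neg_iff [simp]: "phi p s < 0 \<longleftrightarrow> s < 0"
  by (metis sgn_phi sgn_less)

lemma phi_scale: "c > 0 \<Longrightarrow> phi p (c * s) = c powr (p - 1) * phi p s"
  by (simp add: phi_sgn abs_mult powr_mult sgn_mult)

lemma conj_exp_gt_1: "p > 1 \<Longrightarrow> conj_exp p > 1"
  by (simp add: conj_exp_def field_simps)

lemma conj_exp_minus_1: "p > 1 \<Longrightarrow> conj_exp p - 1 = 1 / (p - 1)"
  by (simp add: conj_exp_def field_simps)

lemma conj_exp_conj_exp [simp]: "p > 1 \<Longrightarrow> conj_exp (conj_exp p) = p"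
  by (simp add: conj_exp_def field_simps)

lemma phi_conj_phi [simp]:
  assumes "p > 1" shows "phi (conj_exp p) (phi p s) = s"
proof (cases "s = 0")
  case False
  have "\<bar>phi p s\<bar> powr (conj_exp p - 1) = \<bar>s\<bar>"
    using assms False by (simp add: abs_phi powr_powr conj_exp_minus_1)
  then show ?thesis
    unfolding phi_sgn[of "conj_exp p"] by (simp add: sgn_mult_abs)
qed simp

lemma phi_phi_conj [simp]: "p > 1 \<Longrightarrow> phi p (phi (conj_exp p) w) = w"
  using phi_conj_phi[of "conj_exp p" w] conj_exp_gt_1[of p] by simp

lemma isCont_phi:
  assumes "p > 1" shows "isCont (phi p) s"
proof (cases "s = 0")
  case False
  then show ?thesis
    unfolding phi_def by (intro continuous_intros) auto
next
  case True
  have "((\<lambda>s. \<bar>s\<bar> powr (p - 1)) \<longlongrightarrow> 0 powr (p - 1)) (at (0::real))"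
    by (rule tendsto_powr') (use assms in \<open>auto intro!: tendsto_eq_intros\<close>)
  then have "((\<lambda>s. \<bar>phi p s\<bar>) \<longlongrightarrow> 0) (at 0)"
    using assms by (simp add: abs_phi)
  then have "(phi p \<longlongrightarrow> 0) (at 0)"
    by (rule tendsto_rabs_zero_cancel)
  then show ?thesis
    using True by (simp add: isCont_def phi_def)
qed

lemma continuous_on_phi [continuous_intros]:
  assumes "p > 1" "continuous_on S f" shows "continuous_on S (\<lambda>x. phi p (f x))"
proof -
  have "continuous_on UNIV (phi p)"
    using isCont_phi[OF assms(1)] continuous_at_imp_continuous_on by blast
  from continuous_on_compose2[OF this assms(2)] show ?thesis by simp
qed

lemma kin_nonneg [simp]: "p > 1 \<Longrightarrow> kin p s \<ge> 0"
  using conj_exp_gt_1[of p] by (simp add: kin_def)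

lemma kin_minus [simp]: "kin p (- s) = kin p s"
  by (simp add: kin_def)

lemma kin_scale: "c > 0 \<Longrightarrow> kin p (c * s) = c powr p * kin p s"
  by (simp add: kin_def abs_mult powr_mult)

lemma continuous_on_kin [continuous_intros]:
  assumes "p > 1" "continuous_on S f" shows "continuous_on S (\<lambda>x. kin p (f x))"
  unfolding kin_def using assms by (intro continuous_intros continuous_on_powr') auto

lemma kin_phi_conj:
  assumes "p > 1"
  shows "kin p (phi (conj_exp p) w) = \<bar>w\<bar> powr conj_exp p / conj_exp p"
proof -
  have "(conj_exp p - 1) * p = conj_exp p"
    using assms by (simp add: conj_exp_def field_simps)
  then show ?thesis
    by (simp add: kin_def abs_phi powr_powr)
qed

lemma kin_phi_conj_eq_iff:
  assumes "p > 1"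
  shows "kin p (phi (conj_exp p) w) = kin p (phi (conj_exp p) w') \<longleftrightarrow> \<bar>w\<bar> = \<bar>w'\<bar>"
proof -
  have q: "conj_exp p > 1" using conj_exp_gt_1[OF assms] .
  have "x = y" if "x powr conj_exp p = y powr conj_exp p" "x \<ge> 0" "y \<ge> 0" for x y :: real
  proof (rule linorder_cases[of x y])
    assume "x < y"
    then show ?thesis using powr_less_mono2[of "conj_exp p" x y] that q by simp
  next
    assume "y < x"
    then show ?thesis using powr_less_mono2[of "conj_exp p" y x] that q by simp
  qed
  from this[of "\<bar>w\<bar>" "\<bar>w'\<bar>"] show ?thesis
    using q by (auto simp: kin_phi_conj[OF assms])
qed

lemma kin_phi_conj_eq_0_iff: "p > 1 \<Longrightarrow> kin p (phi (conj_exp p) w) = 0 \<longleftrightarrow> w = 0"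
  using conj_exp_gt_1[of p] by (simp add: kin_phi_conj)

text \<open>As a function of the momentum \<open>w = \<phi>\<^sub>p(s)\<close> the kinetic energy is the power with the conjugate
  exponent, which exceeds \<open>1\<close>; hence it is differentiable even at \<open>w = 0\<close>, where as a function of
  time the velocity may fail to be differentiable.\<close>

lemma has_real_derivative_kin_phi_conj:
  assumes "p > 1"
  shows "((\<lambda>w. kin p (phi (conj_exp p) w)) has_real_derivative phi (conj_exp p) w) (at w)"
proof -
  define q where "q = conj_exp p"
  have q: "q > 1" using conj_exp_gt_1[OF assms] by (simp add: q_def)
  have "((\<lambda>w. \<bar>w\<bar> powr q / q) has_real_derivative phi q w) (at w)"
  proof (cases "w = 0")
    case False
    have "(abs has_real_derivative sgn w) (at w)"
    proof (cases "w > 0")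
      case True
      show ?thesis
        by (rule has_field_derivative_transform_within_open[of "\<lambda>x. x" _ _ "{0<..}"])
          (use True in auto)
    next
      case neg: False
      show ?thesis
        by (rule has_field_derivative_transform_within_open[of "\<lambda>x. - x" _ _ "{..<0}"])
          (use neg False in \<open>auto intro!: derivative_eq_intros\<close>)
    qed
    from DERIV_cdivide[OF DERIV_fun_powr[OF this, of q], of q] show ?thesis
      using q False by (simp add: phi_sgn mult.commute)
  next
    case True
    have "\<bar>h\<bar> powr q / q / h = phi q h / q" if "h \<noteq> 0" for h
    proof -
      have "\<bar>h\<bar> powr q = \<bar>h\<bar> powr (q - 1) * \<bar>h\<bar>"
        using that powr_add[of "\<bar>h\<bar>" "q - 1" 1] by simp
      moreover have "\<bar>h\<bar> / h = sgn h"
        using that by (simp add: sgn_if)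
      ultimately show ?thesis
        by (simp add: phi_sgn mult.assoc flip: times_divide_eq_right)
          (simp add: divide_simps)
    qed
    moreover have "((\<lambda>h. phi q h / q) \<longlongrightarrow> 0) (at 0)"
      using isCont_phi[OF q, of 0] q tendsto_divide_zero[of "phi q" "at 0" q]
      by (simp add: isCont_def phi_def)
    ultimately have "((\<lambda>h. \<bar>h\<bar> powr q / q / h) \<longlongrightarrow> 0) (at 0)"
      by (subst filterlim_cong[OF refl refl, where g = "\<lambda>h. phi q h / q"])
        (auto simp: eventually_at_filter)
    then show ?thesis
      using True q by (simp add: has_field_derivative_iff phi_def)
  qed
  then show ?thesis
    unfolding kin_phi_conj[OF assms] q_def .
qed

lemma phi_mono: "p > 1 \<Longrightarrow> a \<le> b \<Longrightarrow> phi p a \<le> phi p b"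
proof -
  assume p: "p > 1" and ab: "a \<le> b"
  consider "0 \<le> a" | "a < 0" "0 \<le> b" | "b < 0" using ab by linarith
  then show ?thesis
  proof cases
    case 1
    then show ?thesis
      using p ab powr_mono2[of "p - 1" a b]
      by (cases "a = 0"; cases "b = 0") (auto simp: phi_sgn)
  next
    case 2
    then have "phi p a < 0" "\<not> phi p b < 0" by auto
    then show ?thesis by linarith
  next
    case 3
    then show ?thesis
      using p ab powr_mono2[of "p - 1" "- b" "- a"] by (auto simp: phi_sgn)
  qed
qed

section \<open>Calculus on the line\<close>

lemma ex_antiderivative_greaterThanLessThan:
  fixes f :: "real \<Rightarrow> real"
  assumes "a < b" "continuous_on {a<..<b} f"
  obtains F where "\<And>x. x \<in> {a<..<b} \<Longrightarrow> (F has_real_derivative f x) (at x)"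
proof -
  have "\<exists>F. \<forall>x. ereal a < ereal x \<longrightarrow> ereal x < ereal b \<longrightarrow> (F has_vector_derivative f x) (at x)"
    using assms by (intro einterval_antiderivative) (auto simp: continuous_on_eq_continuous_at)
  then show thesis
    using that by (auto simp: has_real_derivative_iff_has_vector_derivative)
qed

lemma ex_antiderivative_UNIV:
  fixes f :: "real \<Rightarrow> real"
  assumes "continuous_on UNIV f"
  obtains F where "\<And>x. (F has_real_derivative f x) (at x)"
proof -
  have "\<exists>F. \<forall>x::real. - \<infinity> < ereal x \<longrightarrow> ereal x < \<infinity> \<longrightarrow> (F has_vector_derivative f x) (at x)"
    using assms by (intro einterval_antiderivative) (auto simp: continuous_on_eq_continuous_at)
  then show thesis
    using that by (auto simp: has_real_derivative_iff_has_vector_derivative)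
qed

lemma integral_eq_antiderivative_diff:
  fixes f F :: "real \<Rightarrow> real"
  assumes "a \<le> b" "\<And>x. x \<in> {a..b} \<Longrightarrow> (F has_real_derivative f x) (at x within {a..b})"
  shows "integral {a..b} f = F b - F a"
  using fundamental_theorem_of_calculus[OF assms(1), of F f] assms(2)
  by (auto simp: has_real_derivative_iff_has_vector_derivative intro!: integral_unique)

text \<open>Separation of variables: an antiderivative \<open>F\<close> of \<open>1 / h\<close> is injective and
  turns every solution into a translate of the identity.\<close>

lemma autonomous_scalar_ode_unique:
  fixes h y1 y2 :: "real \<Rightarrow> real"
  assumes cont: "continuous_on {a<..<b} h" and nz: "\<And>x. x \<in> {a<..<b} \<Longrightarrow> h x \<noteq> 0"
    and S: "open S" "convex S" "t0 \<in> S" "t \<in> S"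
    and y1: "\<And>s. s \<in> S \<Longrightarrow> y1 s \<in> {a<..<b} \<and> (y1 has_real_derivative h (y1 s)) (at s)"
    and y2: "\<And>s. s \<in> S \<Longrightarrow> y2 s \<in> {a<..<b} \<and> (y2 has_real_derivative h (y2 s)) (at s)"
    and init: "y1 t0 = y2 t0"
  shows "y1 t = y2 t"
proof -
  have ab: "a < b" using y1[OF S(3)] by auto
  obtain F where F: "\<And>x. x \<in> {a<..<b} \<Longrightarrow> (F has_real_derivative 1 / h x) (at x)"
    by (rule ex_antiderivative_greaterThanLessThan[OF ab, of "\<lambda>x. 1 / h x"])
      (use nz in \<open>auto intro!: continuous_intros cont\<close>)
  have F1: "((\<lambda>s. F (y s)) has_real_derivative 1) (at s)"
    if "s \<in> S" "\<And>s. s \<in> S \<Longrightarrow> y s \<in> {a<..<b} \<and> (y has_real_derivative h (y s)) (at s)" for y s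
    using DERIV_chain2[OF F, of y s "h (y s)" UNIV] that nz[of "y s"] by auto
  have "\<exists>c. \<forall>s\<in>S. F (y1 s) - F (y2 s) = c"
  proof -
    have "\<exists>c. \<forall>s\<in>S. (\<lambda>s. F (y1 s) - F (y2 s)) s = c"
    proof (rule has_field_derivative_zero_constant)
      show "convex S" by (rule S(2))
      show "((\<lambda>s. F (y1 s) - F (y2 s)) has_real_derivative 0) (at s within S)" if "s \<in> S" for s
        using DERIV_diff[OF F1[OF that y1] F1[OF that y2]] has_field_derivative_at_within by auto
    qed
    then show ?thesis .
  qed
  then have eq: "F (y1 t) = F (y2 t)"
    using S(3,4) init by (metis right_minus_eq)
  have inj: False if "x1 < x2" "x1 \<in> {a<..<b}" "x2 \<in> {a<..<b}" "F x1 = F x2" for x1 x2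
  proof -
    have "\<exists>z>x1. z < x2 \<and> F x2 - F x1 = (x2 - x1) * (1 / h z)"
      by (rule MVT2) (use that F in auto)
    then obtain z where "x1 < z" "z < x2" "F x2 - F x1 = (x2 - x1) * (1 / h z)" by blast
    then show False using that nz[of z] by auto
  qed
  show ?thesis
    using inj[of "y1 t" "y2 t"] inj[of "y2 t" "y1 t"] eq y1[OF S(4)] y2[OF S(4)] by argo
qed

text \<open>Equi-Lipschitz families on the whole line: a diagonal subsequence converges at all
  rationals, hence, by equicontinuity, everywhere.\<close>

lemma equi_lipschitz_subsequence:
  fixes f :: "nat \<Rightarrow> real \<Rightarrow> real"
  assumes bound: "\<And>n x. \<bar>f n x\<bar> \<le> B" and lip: "\<And>n x y. \<bar>f n x - f n y\<bar> \<le> L * \<bar>x - y\<bar>"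
  obtains r g where "strict_mono (r :: nat \<Rightarrow> nat)" "\<And>x. (\<lambda>k. f (r k) x) \<longlonglongrightarrow> g x"
proof -
  obtain r :: "nat \<Rightarrow> nat" where r: "strict_mono r"
    "\<And>x. x \<in> \<rat> \<Longrightarrow> \<exists>l. (\<lambda>n. f (r n) x) \<longlonglongrightarrow> l"
    by (rule function_convergent_subsequence[of "\<rat>" f B])
      (use bound in \<open>auto simp: countable_rat\<close>)
  have "convergent (\<lambda>k. f (r k) x)" for x
  proof -
    have "Cauchy (\<lambda>k. f (r k) x)"
    proof (rule metric_CauchyI)
      fix e :: real assume e: "e > 0"
      define d where "d = e / (3 * (\<bar>L\<bar> + 1))"
      have d: "d > 0" "\<bar>L\<bar> * d < e / 3"
        using e by (auto simp: d_def field_simps)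
      obtain z where z: "z \<in> \<rat>" "x < z" "z < x + d"
        using Rats_dense_in_real[of x "x + d"] d(1) by auto
      have near: "\<bar>f n x - f n z\<bar> < e / 3" for n
      proof -
        have "\<bar>f n x - f n z\<bar> \<le> L * \<bar>x - z\<bar>" by (rule lip)
        also have "\<dots> \<le> \<bar>L\<bar> * d"
          using z by (intro mult_mono) auto
        finally show ?thesis using d by simp
      qed
      have "Cauchy (\<lambda>k. f (r k) z)"
        using r(2)[OF z(1)] by (auto simp: convergent_def intro: LIMSEQ_imp_Cauchy)
      then obtain N where N: "\<And>m n. m \<ge> N \<Longrightarrow> n \<ge> N \<Longrightarrow> dist (f (r m) z) (f (r n) z) < e / 3"
        using metric_CauchyD[of _ "e / 3"] e by fastforce
      have "dist (f (r m) x) (f (r n) x) < e" if "m \<ge> N" "n \<ge> N" for m n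
        using near[of "r m"] near[of "r n"] N[OF that] unfolding dist_real_def by linarith
      then show "\<exists>N. \<forall>m\<ge>N. \<forall>n\<ge>N. dist (f (r m) x) (f (r n) x) < e" by blast
    qed
    then show ?thesis by (simp add: Cauchy_convergent_iff)
  qed
  then have "\<And>x. (\<lambda>k. f (r k) x) \<longlonglongrightarrow> lim (\<lambda>k. f (r k) x)"
    by (simp add: convergent_LIMSEQ_iff)
  then show thesis by (rule that[OF r(1)])
qed

lemma bounded_limit_integral:
  fixes f :: "nat \<Rightarrow> real \<Rightarrow> real"
  assumes "\<And>k. continuous_on {a..b} (f k)" "\<And>k x. x \<in> {a..b} \<Longrightarrow> \<bar>f k x\<bar> \<le> B"
    and "\<And>x. x \<in> {a..b} \<Longrightarrow> (\<lambda>k. f k x) \<longlonglongrightarrow> g x"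
  shows "(\<lambda>k. integral {a..b} (f k)) \<longlonglongrightarrow> integral {a..b} g"
  by (rule dominated_convergence(2)[where h = "\<lambda>_. B"])
    (use assms in \<open>auto intro: integrable_continuous_interval\<close>)

text \<open>Pointwise limits of functions and of their uniformly bounded derivatives satisfy the
  integral form of the limit equation, by bounded convergence.\<close>

lemma bounded_limit_has_derivative:
  fixes f f' :: "nat \<Rightarrow> real \<Rightarrow> real"
  assumes der: "\<And>s t. s < t \<Longrightarrow> \<forall>\<^sub>F j in sequentially. \<forall>y\<in>{s..t}.
      (f j has_real_derivative f' j y) (at y within {s..t})"
    and cont: "\<And>j. continuous_on UNIV (f' j)" and bd: "\<And>j y. \<bar>f' j y\<bar> \<le> B"
    and lim: "\<And>y. (\<lambda>j. f j y) \<longlonglongrightarrow> g y" and lim': "\<And>y. (\<lambda>j. f' j y) \<longlonglongrightarrow> g' y"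
    and contg: "continuous_on UNIV g'"
  shows "(g has_real_derivative g' y) (at y)"
proof -
  have int: "g t = g s + integral {s..t} g'" if "s < t" for s t
  proof -
    have "(\<lambda>j. integral {s..t} (f' j)) \<longlonglongrightarrow> integral {s..t} g'"
      by (rule bounded_limit_integral[where B = B])
        (use cont bd lim' in \<open>auto intro: continuous_on_subset\<close>)
    moreover have "\<forall>\<^sub>F j in sequentially. integral {s..t} (f' j) = f j t - f j s"
      using der[OF that] by eventually_elim
        (use that in \<open>auto intro!: integral_eq_antiderivative_diff\<close>)
    ultimately have "(\<lambda>j. f j t - f j s) \<longlonglongrightarrow> integral {s..t} g'"
      using tendsto_cong by fastforce
    moreover have "(\<lambda>j. f j t - f j s) \<longlonglongrightarrow> g t - g s"
      by (intro tendsto_intros lim)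
    ultimately show ?thesis
      using LIMSEQ_unique by fastforce
  qed
  have "((\<lambda>x. integral {y - 1..x} g') has_real_derivative g' y) (at y within {y - 1..y + 1})"
    by (rule integral_has_real_derivative) (auto intro: continuous_on_subset[OF contg])
  then have "((\<lambda>x. g (y - 1) + integral {y - 1..x} g') has_real_derivative g' y) (at y)"
    by (auto simp: at_within_Icc_at intro!: derivative_eq_intros)
  then show ?thesis
    by (rule has_field_derivative_transform_within_open[where S = "{y - 1<..<y + 1}"])
      (use int[symmetric] in auto)
qed

text \<open>Windows of length \<open>h\<close> tile the interval up to a remainder shorter than \<open>h\<close>, and on the
  remainder the Lipschitz bound applies. The lemma carries estimates from a short scale to a long one,
  both for averages over many periods and for the passage from windows of length of order \<open>\<epsilon>\<close> to
  fixed intervals.\<close>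

lemma increment_le_of_windows:
  fixes G :: "real \<Rightarrow> real"
  assumes h: "h > 0" and cd: "c \<le> d" and "B \<ge> 0" "\<eta> \<ge> 0"
    and win: "\<And>z. c \<le> z \<Longrightarrow> z + h \<le> d \<Longrightarrow> \<bar>G (z + h) - G z\<bar> \<le> \<eta> * h"
    and lip: "\<And>x y. c \<le> x \<Longrightarrow> x \<le> y \<Longrightarrow> y \<le> d \<Longrightarrow> \<bar>G y - G x\<bar> \<le> B * (y - x)"
  shows "\<bar>G d - G c\<bar> \<le> \<eta> * (d - c) + B * h"
proof -
  define N where "N = nat \<lfloor>(d - c) / h\<rfloor>"
  have "real N = of_int \<lfloor>(d - c) / h\<rfloor>"
    using h cd by (simp add: N_def)
  then have "real N \<le> (d - c) / h" "(d - c) / h < real N + 1"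
    using floor_correct[of "(d - c) / h"] by auto
  then have N: "real N * h \<le> d - c" "d - c < real N * h + h"
    using h by (auto simp: field_simps)
  have "\<bar>G (c + real k * h) - G c\<bar> \<le> \<eta> * (real k * h)" if "k \<le> N" for k
    using that
  proof (induction k)
    case (Suc k)
    have "real (Suc k) * h \<le> real N * h"
      using Suc.prems h by (intro mult_right_mono) auto
    then have "\<bar>G (c + real k * h + h) - G (c + real k * h)\<bar> \<le> \<eta> * h"
      using N h by (intro win) (auto simp: algebra_simps)
    with Suc show ?case by (auto simp: algebra_simps)
  qed simp
  from this[of N] have "\<bar>G (c + real N * h) - G c\<bar> \<le> \<eta> * (real N * h)" by simp
  also have "\<dots> \<le> \<eta> * (d - c)"
    using N assms(4) by (intro mult_left_mono) auto
  finally have 1: "\<bar>G (c + real N * h) - G c\<bar> \<le> \<eta> * (d - c)" .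
  have "\<bar>G d - G (c + real N * h)\<bar> \<le> B * (d - (c + real N * h))"
    using N h by (intro lip) auto
  also have "\<dots> \<le> B * h"
    using N assms(3) by (intro mult_left_mono) auto
  finally show ?thesis using 1 by linarith
qed

lemma deriv_on_eqI:
  assumes "(f has_real_derivative d) (at x within {a..b})" "a < b" "x \<in> {a..b}"
  shows "deriv_on {a..b} f x = d"
  unfolding deriv_on_def using assms
  by (intro vector_derivative_within_closed_interval)
    (auto simp: has_real_derivative_iff_has_vector_derivative)

lemma deriv_on_UNIV_eqI:
  "(f has_real_derivative d) (at x) \<Longrightarrow> deriv_on UNIV f x = d"
  by (simp add: deriv_on_def has_real_derivative_iff_has_vector_derivative vector_derivative_at)

lemma differentiable_on_has_deriv_on:
  "f differentiable_on S \<Longrightarrow> x \<in> S \<Longrightarrow> (f has_real_derivative deriv_on S f x) (at x within S)"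
  unfolding deriv_on_def has_real_derivative_iff_has_vector_derivative
  by (meson differentiable_onD vector_derivative_works)

lemma C1_on_has_deriv_on:
  "C1_on S f \<Longrightarrow> x \<in> S \<Longrightarrow> (f has_real_derivative deriv_on S f x) (at x within S)"
  by (simp add: C1_on_def differentiable_on_has_deriv_on)

lemma increment_le_of_derivative_le:
  fixes f f' :: "real \<Rightarrow> real"
  assumes "a \<le> b" "\<And>x. a \<le> x \<Longrightarrow> x \<le> b \<Longrightarrow> (f has_real_derivative f' x) (at x)"
    and "\<And>x. a \<le> x \<Longrightarrow> x \<le> b \<Longrightarrow> f' x \<le> k"
  shows "f b - f a \<le> k * (b - a)"
proof (cases "a = b")
  case False
  then have "\<exists>z>a. z < b \<and> f b - f a = (b - a) * f' z"
    using assms by (intro MVT2) auto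
  then obtain z where "a < z" "z < b" "f b - f a = (b - a) * f' z" by blast
  then show ?thesis
    using assms(1) assms(3)[of z] mult_left_mono[of "f' z" k "b - a"] by (simp add: mult.commute)
qed simp

lemma constant_sgn:
  fixes f :: "real \<Rightarrow> real"
  assumes "continuous_on UNIV f" "\<And>t. f t \<noteq> 0"
  shows "sgn (f t) = sgn (f s)"
proof (rule ccontr)
  assume ne: "sgn (f t) \<noteq> sgn (f s)"
  have c: "connected (range f)"
    using assms(1) connected_UNIV by (rule connected_continuous_image)
  have "0 \<in> range f"
    using ne assms(2)[of t] assms(2)[of s] connectedD_interval[OF c, of "f t" "f s" 0]
      connectedD_interval[OF c, of "f s" "f t" 0]
    by (cases "f t < 0"; cases "f s < 0") (auto simp: sgn_if)
  then show False using assms(2) by auto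
qed

text \<open>The multiples of a small period are nearly dense, so arbitrarily small periods would make \<open>v\<close>
  constant; and the periods form a closed set. So their infimum is attained, which is what
  the \<open>LEAST\<close> in \<open>min_period\<close> needs.\<close>

lemma min_period_is_period:
  fixes v :: "real \<Rightarrow> real"
  assumes cont: "continuous_on UNIV v" and T0: "T0 > 0" "\<And>y. v (y + T0) = v y"
    and nonconst: "v a \<noteq> v b"
  shows "min_period v > 0" "v (y + min_period v) = v y"
proof -
  define Q where "Q = {T. \<forall>y. v (y + T) = v y}"
  define P where "P = {T. T > 0 \<and> T \<in> Q}"
  have P: "T0 \<in> P" using T0 by (auto simp: P_def Q_def)
  have bdd: "bdd_below P" by (rule bdd_belowI[of _ 0]) (auto simp: P_def)
  have mult: "v (x + real_of_int k * T) = v x" if "T \<in> Q" for x k T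
  proof -
    have nat: "v (x + real n * T) = v x" for n x
    proof (induction n)
      case (Suc n)
      have "v (x + real (Suc n) * T) = v ((x + real n * T) + T)" by (simp add: algebra_simps)
      also have "\<dots> = v x" using that Suc by (auto simp: Q_def)
      finally show ?case .
    qed simp
    show ?thesis
    proof (cases "k \<ge> 0")
      case True
      then show ?thesis using nat[of x "nat k"] by simp
    next
      case False
      then show ?thesis using nat[of "x + real_of_int k * T" "nat (- k)"] by simp
    qed
  qed
  have "closed Q"
    unfolding Q_def by (intro closed_Collect_all closed_Collect_eq continuous_intros
        continuous_on_compose2[OF cont]) auto
  moreover have "Inf P \<in> closure P"
    using P bdd by (intro closure_contains_Inf) auto
  moreover have "P \<subseteq> Q" by (auto simp: P_def)
  ultimately have InfQ: "Inf P \<in> Q"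
    using closure_minimal by blast
  have "Inf P \<noteq> 0"
  proof
    assume Inf0: "Inf P = 0"
    have "isCont v b" using cont by (simp add: continuous_on_eq_continuous_at)
    then obtain d where d: "d > 0" "\<And>z. dist z b < d \<Longrightarrow> dist (v z) (v b) < \<bar>v a - v b\<bar>"
      using nonconst unfolding continuous_at_eps_delta by (metis right_minus_eq zero_less_abs_iff)
    obtain T where T: "T \<in> P" "T < d"
      using d(1) Inf0 P cInf_lessD[of P d] by auto
    \<comment> \<open>a multiple of the small period \<open>T\<close> carries \<open>a\<close> close to \<open>b\<close>\<close>
    define k where "k = \<lfloor>(b - a) / T\<rfloor>"
    have Tpos: "T > 0" using T by (auto simp: P_def)
    have "real_of_int k \<le> (b - a) / T" "(b - a) / T < real_of_int k + 1"
      unfolding k_def using floor_correct[of "(b - a) / T"] by auto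
    then have "real_of_int k * T \<le> b - a" "b - a < real_of_int k * T + T"
      using Tpos by (auto simp: field_simps)
    then have "dist (a + real_of_int k * T) b < d"
      using T by (auto simp: dist_real_def)
    from d(2)[OF this] show False
      using mult[of T a k] T by (auto simp: P_def dist_real_def)
  qed
  moreover have "Inf P \<ge> 0"
    using P by (intro cInf_greatest) (auto simp: P_def)
  ultimately have "Inf P \<in> P" using InfQ by (auto simp: P_def)
  moreover have "min_period v = Inf P"
    unfolding min_period_def
    by (rule Least_equality) (use calculation bdd in \<open>auto simp: P_def Q_def intro!: cInf_lower\<close>)
  ultimately show "min_period v > 0" "v (y + min_period v) = v y"
    by (auto simp: P_def Q_def)
qed

lemma tendsto_uniform_limit_compose:
  fixes f :: "nat \<Rightarrow> real \<Rightarrow> real"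
  assumes lim: "uniform_limit S f g sequentially" and cont: "continuous_on S g"
    and n: "filterlim n at_top sequentially" and x: "x \<longlonglongrightarrow> x0" "x0 \<in> S" "\<And>j. x j \<in> S"
  shows "(\<lambda>j. f (n j) (x j)) \<longlonglongrightarrow> g x0"
proof -
  have "(\<lambda>j. f (n j) (x j) - g (x j)) \<longlonglongrightarrow> 0"
  proof (rule tendstoI)
    fix d :: real assume "d > 0"
    with lim have "\<forall>\<^sub>F k in sequentially. \<forall>y\<in>S. dist (f k y) (g y) < d"
      by (auto simp: uniform_limit_iff)
    from eventually_compose_filterlim[OF this n]
    show "\<forall>\<^sub>F j in sequentially. dist (f (n j) (x j) - g (x j)) 0 < d"
      by eventually_elim (use x(3) in \<open>auto simp: dist_real_def\<close>)
  qed
  moreover have "(\<lambda>j. g (x j)) \<longlonglongrightarrow> g x0"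
    by (rule continuous_on_tendsto_compose[OF cont x(1,2)]) (use x(3) in auto)
  ultimately have "(\<lambda>j. (f (n j) (x j) - g (x j)) + g (x j)) \<longlonglongrightarrow> 0 + g x0"
    by (rule tendsto_add)
  then show ?thesis by simp
qed

lemma bounded_of_continuous:
  fixes f :: "real \<Rightarrow> real"
  assumes "continuous_on {l..r} f"
  obtains B where "B > 0" "\<And>x. x \<in> {l..r} \<Longrightarrow> \<bar>f x\<bar> \<le> B"
proof -
  have "bounded (f ` {l..r})"
    by (intro compact_imp_bounded compact_continuous_image assms) simp
  then obtain B where "B > 0" "\<forall>y \<in> f ` {l..r}. norm y \<le> B"
    unfolding bounded_pos by blast
  then show thesis by (intro that[of B]) auto
qed

lemma continuous_on_limit_equi_lipschitz:
  fixes f :: "nat \<Rightarrow> real \<Rightarrow> real"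
  assumes lim: "\<And>x. (\<lambda>n. f n x) \<longlonglongrightarrow> g x"
    and lip: "\<And>n x y. \<bar>f n x - f n y\<bar> \<le> L * \<bar>x - y\<bar>"
  shows "continuous_on UNIV g"
proof -
  have "\<bar>g x - g y\<bar> \<le> L * \<bar>x - y\<bar>" for x y
    by (rule LIMSEQ_le_const2[of "\<lambda>n. \<bar>f n x - f n y\<bar>"])
      (auto intro!: tendsto_intros lim lip)
  moreover have "L \<ge> 0" using lip[of 0 1 0] by simp
  ultimately have "L-lipschitz_on UNIV g"
    by (intro lipschitz_onI) (auto simp: dist_real_def)
  then show ?thesis by (rule lipschitz_on_continuous_on)
qed

text \<open>The expansions of the potential enter only through the upper bound \<open>O(\<bar>s - c\<bar>\<^sup>p)\<close> that they
  imply; the next lemmas extract the value, the derivative and a global bound from it.\<close>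

lemma eventually_le_of_smallo_power:
  fixes W :: "real \<Rightarrow> real"
  assumes "(\<lambda>s. W s - c0 * \<bar>s - c\<bar> powr p) \<in> o[F](\<lambda>s. \<bar>s - c\<bar> powr p)"
  shows "\<forall>\<^sub>F s in F. \<bar>W s\<bar> \<le> (\<bar>c0\<bar> + 1) * \<bar>s - c\<bar> powr p"
  using landau_o.smallD[OF assms zero_less_one]
proof eventually_elim
  case (elim s)
  have "\<bar>W s\<bar> \<le> \<bar>W s - c0 * \<bar>s - c\<bar> powr p\<bar> + \<bar>c0 * \<bar>s - c\<bar> powr p\<bar>" by linarith
  also have "\<dots> \<le> \<bar>s - c\<bar> powr p + \<bar>c0\<bar> * \<bar>s - c\<bar> powr p"
    using elim by (simp add: abs_mult)
  finally show ?case by (simp add: algebra_simps)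
qed

lemma tendsto_abs_diff_powr_zero:
  fixes c :: real
  assumes "p > 0" shows "((\<lambda>s. k * \<bar>s - c\<bar> powr p) \<longlongrightarrow> 0) (at c within S)"
proof -
  have "((\<lambda>s. \<bar>s - c\<bar>) \<longlongrightarrow> \<bar>c - c\<bar>) (at c within S)"
    by (intro tendsto_intros)
  then have "((\<lambda>s. k * \<bar>s - c\<bar> powr p) \<longlongrightarrow> k * \<bar>c - c\<bar> powr p) (at c within S)"
    by (intro tendsto_mult_left tendsto_powr') (use assms in auto)
  then show ?thesis using assms by simp
qed

lemma zero_of_le_power:
  fixes W :: "real \<Rightarrow> real"
  assumes le: "\<forall>\<^sub>F s in at c within S. \<bar>W s\<bar> \<le> k * \<bar>s - c\<bar> powr p" and p: "p > 0"
    and cont: "(W \<longlongrightarrow> W c) (at c within S)" and nt: "at c within S \<noteq> bot"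
  shows "W c = 0"
proof -
  have "(W \<longlongrightarrow> 0) (at c within S)"
    by (rule Lim_null_comparison[OF _ tendsto_abs_diff_powr_zero[OF p]]) (use le in simp)
  then show ?thesis using tendsto_unique[OF nt cont] by blast
qed

lemma deriv_zero_of_le_power:
  fixes W :: "real \<Rightarrow> real"
  assumes le: "\<forall>\<^sub>F s in at c within S. \<bar>W s\<bar> \<le> k * \<bar>s - c\<bar> powr p" and p: "p > 1"
    and deriv: "(W has_real_derivative d) (at c within S)" and nt: "at c within S \<noteq> bot"
    and zero: "W c = 0"
  shows "d = 0"
proof -
  have "((\<lambda>s. (W s - W c) / (s - c)) \<longlongrightarrow> 0) (at c within S)"
  proof (rule Lim_null_comparison[OF _ tendsto_abs_diff_powr_zero])
    have "\<forall>\<^sub>F s in at c within S. s \<noteq> c" by (simp add: eventually_at_filter)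
    with le show "\<forall>\<^sub>F s in at c within S. norm ((W s - W c) / (s - c)) \<le> k * \<bar>s - c\<bar> powr (p - 1)"
    proof eventually_elim
      case (elim s)
      have "\<bar>s - c\<bar> powr p = \<bar>s - c\<bar> powr (p - 1) * \<bar>s - c\<bar>"
        using elim powr_add[of "\<bar>s - c\<bar>" "p - 1" 1] by simp
      with elim show ?case using zero by (simp add: abs_divide divide_le_eq mult.assoc)
    qed
  qed (use p in simp)
  moreover have "((\<lambda>s. (W s - W c) / (s - c)) \<longlongrightarrow> d) (at c within S)"
    using deriv by (simp add: has_field_derivative_iff)
  ultimately show ?thesis using tendsto_unique[OF nt] by blast
qed

lemma ex_global_power_bound:
  fixes W :: "real \<Rightarrow> real"
  assumes le: "\<forall>\<^sub>F s in at c within S. \<bar>W s\<bar> \<le> k * \<bar>s - c\<bar> powr p"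
    and k: "k \<ge> 0" and p: "p > 0" and zero: "W c = 0" and bd: "\<And>s. s \<in> S \<Longrightarrow> W s \<le> B"
  obtains C where "C \<ge> 0" "\<And>s. s \<in> S \<Longrightarrow> W s \<le> C * \<bar>s - c\<bar> powr p"
proof -
  obtain \<delta> where \<delta>: "\<delta> > 0" "\<And>s. s \<in> S \<Longrightarrow> s \<noteq> c \<Longrightarrow> dist s c < \<delta> \<Longrightarrow> \<bar>W s\<bar> \<le> k * \<bar>s - c\<bar> powr p"
    using le by (auto simp: eventually_at)
  define C where "C = k + \<bar>B\<bar> / \<delta> powr p"
  have C: "C \<ge> 0" "k \<le> C" using k by (auto simp: C_def)
  have "W s \<le> C * \<bar>s - c\<bar> powr p" if s: "s \<in> S" for s
  proof -
    consider "s = c" | "s \<noteq> c" "\<bar>s - c\<bar> < \<delta>" | "\<bar>s - c\<bar> \<ge> \<delta>" by linarith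
    then show ?thesis
    proof cases
      case 1
      then show ?thesis using zero p by simp
    next
      case 2
      then have "W s \<le> k * \<bar>s - c\<bar> powr p" using \<delta>(2)[OF s] by (simp add: dist_real_def abs_le_iff)
      also have "\<dots> \<le> C * \<bar>s - c\<bar> powr p" using C by (intro mult_right_mono) auto
      finally show ?thesis .
    next
      case 3
      have "W s \<le> \<bar>B\<bar> / \<delta> powr p * \<delta> powr p" using bd[OF s] \<delta>(1) by simp
      also have "\<dots> \<le> C * \<bar>s - c\<bar> powr p"
        using 3 \<delta>(1) p C k by (intro mult_mono powr_mono2) (auto simp: C_def)
      finally show ?thesis .
    qed
  qed
  with C(1) that show thesis by blast
qed

section \<open>Orbits of the autonomous equation\<close>

text \<open>The features of the potential that govern the orbits: it decreases from its maximum at \<open>0\<close>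
  towards the zeros at \<open>-1\<close> and \<open>1\<close>, and vanishes there at least to order \<open>p\<close>. They are
  invariant under \<open>v \<mapsto> -v\<close>, so whatever holds for the right well carries over to the left one.\<close>

locale double_well =
  fixes p :: real and W D :: "real \<Rightarrow> real" and W0 C :: real
  assumes p: "p > 1"
    and W_deriv: "\<And>x. x \<in> {-1..1} \<Longrightarrow> (W has_real_derivative D x) (at x within {-1..1})"
    and D_cont: "continuous_on {-1..1} D"
    and D_neg: "\<And>x. 0 < x \<Longrightarrow> x < 1 \<Longrightarrow> D x < 0"
    and D_pos: "\<And>x. -1 < x \<Longrightarrow> x < 0 \<Longrightarrow> D x > 0"
    and W_0: "W 0 = W0"
    and W_right: "\<And>x. x \<in> {-1..1} \<Longrightarrow> W x \<le> C * (1 - x) powr p"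
    and W_left: "\<And>x. x \<in> {-1..1} \<Longrightarrow> W x \<le> C * (1 + x) powr p"
    and W_ends: "W 1 = 0" "W (-1) = 0"
begin

abbreviation \<psi> :: "real \<Rightarrow> real" where "\<psi> \<equiv> phi (conj_exp p)"

lemma conj_gt_1: "conj_exp p > 1"
  using p by (rule conj_exp_gt_1)

lemma reflected: "double_well p (\<lambda>x. W (- x)) (\<lambda>x. - D (- x)) W0 C"
proof
  fix x :: real assume x: "x \<in> {-1..1}"
  have "(W has_real_derivative D (- x)) (at (- x) within uminus ` {-1..1})"
    using W_deriv[of "- x"] x by simp
  from DERIV_image_chain[OF this DERIV_minus[OF DERIV_ident]]
  show "((\<lambda>x. W (- x)) has_real_derivative - D (- x)) (at x within {-1..1})"
    by (simp add: o_def)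
  show "W (- x) \<le> C * (1 - x) powr p" "W (- x) \<le> C * (1 + x) powr p"
    using W_left[of "- x"] W_right[of "- x"] x by auto
qed (use p D_neg D_pos W_0 W_ends in
    \<open>auto intro!: continuous_intros continuous_on_compose2[OF D_cont]\<close>)

lemma W_cont: "continuous_on {-1..1} W"
  using W_deriv by (meson DERIV_continuous continuous_on_eq_continuous_within)

lemma W_at: "-1 < x \<Longrightarrow> x < 1 \<Longrightarrow> (W has_real_derivative D x) (at x)"
  using W_deriv[of x] by (simp add: at_within_Icc_at)

lemma W_strict_antimono:
  assumes "0 \<le> x" "x < y" "y \<le> 1" shows "W y < W x"
proof -
  have "\<exists>z>x. z < y \<and> W y - W x = (y - x) * D z"
  proof -
    have "\<And>z. x < z \<Longrightarrow> z < y \<Longrightarrow> (W has_real_derivative D z) (at z)"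
      using assms by (intro W_at) auto
    moreover have "continuous_on {x..y} W"
      using assms by (intro continuous_on_subset[OF W_cont]) auto
    ultimately show ?thesis
      using MVT[of x y W] assms(2) DERIV_unique real_differentiable_def by metis
  qed
  then obtain z where z: "x < z" "z < y" "W y - W x = (y - x) * D z" by blast
  have "(y - x) * D z < 0"
    using z assms by (intro mult_pos_neg D_neg) auto
  with z show ?thesis by simp
qed

lemma W_nonneg_right: "0 \<le> x \<Longrightarrow> x \<le> 1 \<Longrightarrow> 0 \<le> W x \<and> W x \<le> W0"
  using W_strict_antimono[of x 1] W_strict_antimono[of 0 x] W_0 W_ends
  by (cases "x = 1"; cases "x = 0") auto

lemma W_bounds: "x \<in> {-1..1} \<Longrightarrow> 0 \<le> W x \<and> W x \<le> W0"
  using W_nonneg_right[of x] double_well.W_nonneg_right[OF reflected, of "- x"]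
  by (cases "x \<ge> 0") auto

lemma W0_pos: "W0 > 0"
  using W_strict_antimono[of 0 1] W_0 W_ends by simp

text \<open>Hamiltonian form of the autonomous equation, with the momentum \<open>w = \<phi>\<^sub>p(v')\<close> as second unknown.
  Both equations have continuous right-hand sides, whereas for \<open>p > 2\<close> the equation solved for
  \<open>v''\<close> is singular where \<open>v' = 0\<close>.\<close>

definition orbit :: "real \<Rightarrow> (real \<Rightarrow> real) \<Rightarrow> (real \<Rightarrow> real) \<Rightarrow> bool" where
  "orbit \<xi> v w \<longleftrightarrow> (\<forall>t. v t \<in> {-1..1} \<and> (v has_real_derivative \<psi> (w t)) (at t) \<and>
     (w has_real_derivative D (v t)) (at t) \<and> kin p (\<psi> (w t)) = W (v t) - \<xi>)"

lemma orbitD: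
  assumes "orbit \<xi> v w"
  shows "v t \<in> {-1..1}" "(v has_real_derivative \<psi> (w t)) (at t)"
    "(w has_real_derivative D (v t)) (at t)" "kin p (\<psi> (w t)) = W (v t) - \<xi>"
    "-1 \<le> v t" "v t \<le> 1" "isCont v t" "isCont w t"
  using assms by (auto simp: orbit_def intro: DERIV_isCont)

lemma orbit_continuous_on:
  assumes "orbit \<xi> v w"
  shows "continuous_on S v" "continuous_on S w"
  using orbitD(7,8)[OF assms] by (auto intro: continuous_at_imp_continuous_on)

lemma orbit_shift: "orbit \<xi> v w \<Longrightarrow> orbit \<xi> (\<lambda>t. v (t + s)) (\<lambda>t. w (t + s))"
  by (simp add: orbit_def DERIV_shift[symmetric])

lemma orbit_reflect:
  assumes "orbit \<xi> v w"
  shows "double_well.orbit p (\<lambda>x. W (- x)) (\<lambda>x. - D (- x)) \<xi> (\<lambda>t. - v t) (\<lambda>t. - w t)"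
  unfolding double_well.orbit_def[OF reflected]
  using orbitD[OF assms] by (auto intro!: derivative_eq_intros)

lemma orbit_energy_le: "orbit \<xi> v w \<Longrightarrow> \<xi> \<le> W (v t)"
  using orbitD(4)[of \<xi> v w t] kin_nonneg[OF p, of "\<psi> (w t)"] by linarith

text \<open>At a point with \<open>v > 0\<close> the potential is invertible, so the energy identity expresses
  \<open>v\<close> through \<open>w\<close>, and \<open>w\<close> solves a scalar autonomous equation with non-zero right-hand side.
  Turning points, where \<open>w = 0\<close> and the velocity is not a Lipschitz function of \<open>v\<close>, are
  included.\<close>

lemma orbit_unique_near_pos:
  assumes o1: "orbit \<xi> v1 w1" and o2: "orbit \<xi> v2 w2" and \<xi>: "0 < \<xi>"
    and init: "v1 t0 = v2 t0" "w1 t0 = w2 t0" and pos: "v1 t0 > 0"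
  shows "\<exists>d>0. \<forall>t. \<bar>t - t0\<bar> < d \<longrightarrow> v1 t = v2 t \<and> w1 t = w2 t"
proof -
  define q where "q = conj_exp p"
  have q: "q > 1" using conj_gt_1 by (simp add: q_def)
  have kinw: "kin p (\<psi> w) = \<bar>w\<bar> powr q / q" for w
    using kin_phi_conj[OF p] by (simp add: q_def)
  obtain V where V: "\<And>x. x \<in> {0..1} \<Longrightarrow> V (W x) = x" and Vcont: "continuous_on {0..W0} V"
  proof -
    have inj: "inj_on W {0..1}"
      by (rule linorder_inj_onI') (use W_strict_antimono in force)
    have c: "continuous_on {0..1} W"
      by (rule continuous_on_subset[OF W_cont]) auto
    have "{0..W0} \<subseteq> W ` {0..1}"
    proof
      fix y assume y: "y \<in> {0..W0}"
      have "\<exists>x. 0 \<le> x \<and> x \<le> 1 \<and> W x = y"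
        by (rule IVT2') (use y W_0 W_ends c in auto)
      then show "y \<in> W ` {0..1}" by auto
    qed
    moreover have "continuous_on (W ` {0..1}) (the_inv_into {0..1} W)"
      by (rule continuous_on_inv[OF c]) (auto simp: the_inv_into_f_f[OF inj])
    ultimately show thesis
      using that[of "the_inv_into {0..1} W"] the_inv_into_f_f[OF inj] continuous_on_subset by blast
  qed
  have V_range: "V y \<in> {0<..<1}" if "0 < y" "y < W0" for y
  proof -
    have "continuous_on {0..1} W" by (rule continuous_on_subset[OF W_cont]) auto
    then have "\<exists>x. 0 \<le> x \<and> x \<le> 1 \<and> W x = y"
      using that W_0 W_ends by (intro IVT2') auto
    then obtain x where "0 \<le> x" "x \<le> 1" "W x = y" by blast
    then show ?thesis
      using V[of x] that W_0 W_ends by (cases "x = 0"; cases "x = 1") auto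
  qed
  \<comment> \<open>the momentum has modulus \<open>m\<close> exactly where \<open>v = 0\<close>, so \<open>\<bar>w\<bar> < m\<close> when \<open>v > 0\<close>\<close>
  define m where "m = (q * (W0 - \<xi>)) powr (1 / q)"
  define h where "h w = D (V (\<xi> + \<bar>w\<bar> powr q / q))" for w
  have "W (v1 t0) < W0"
    using W_strict_antimono[of 0 "v1 t0"] pos orbitD(6)[OF o1] W_0 by auto
  then have \<xi>W: "\<xi> < W0" using orbit_energy_le[OF o1, of t0] by linarith
  have m: "\<bar>w\<bar> < m \<longleftrightarrow> \<xi> + \<bar>w\<bar> powr q / q < W0" for w
  proof -
    have "\<bar>w\<bar> < m \<longleftrightarrow> \<bar>w\<bar> powr q < m powr q"
      using q by (metis abs_ge_zero less_trans powr_less_mono2 powr_ge_zero zero_less_one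
          not_less_iff_gr_or_eq m_def)
    also have "m powr q = q * (W0 - \<xi>)"
      using q \<xi>W by (simp add: m_def powr_powr)
    finally show ?thesis using q by (simp add: field_simps)
  qed
  have range: "\<xi> + \<bar>w\<bar> powr q / q \<ge> \<xi>" for w using q by simp
  have h_cont: "continuous_on {-m<..<m} h"
    unfolding h_def
  proof (intro continuous_on_compose2[OF D_cont] continuous_on_compose2[OF Vcont])
    show "continuous_on {-m<..<m} (\<lambda>w. \<xi> + \<bar>w\<bar> powr q / q)"
      using q by (intro continuous_intros continuous_on_powr') auto
    show "(\<lambda>w. \<xi> + \<bar>w\<bar> powr q / q) ` {-m<..<m} \<subseteq> {0..W0}"
    proof clarify
      fix w :: real assume "w \<in> {-m<..<m}"
      then have "\<xi> + \<bar>w\<bar> powr q / q < W0" using m[of w] by auto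
      with range[of w] \<xi> show "\<xi> + \<bar>w\<bar> powr q / q \<in> {0..W0}" by auto
    qed
    show "(\<lambda>w. V (\<xi> + \<bar>w\<bar> powr q / q)) ` {-m<..<m} \<subseteq> {-1..1}"
    proof clarify
      fix w :: real assume "w \<in> {-m<..<m}"
      then have "\<xi> + \<bar>w\<bar> powr q / q < W0" using m[of w] by auto
      with V_range[OF _ this] range[of w] \<xi> show "V (\<xi> + \<bar>w\<bar> powr q / q) \<in> {-1..1}"
        by fastforce
    qed
  qed
  have h_nz: "h w \<noteq> 0" if "w \<in> {-m<..<m}" for w
  proof -
    have "\<xi> + \<bar>w\<bar> powr q / q < W0" using m[of w] that by auto
    with V_range[OF _ this] range[of w] \<xi> show ?thesis
      using D_neg[of "V (\<xi> + \<bar>w\<bar> powr q / q)"] by (force simp: h_def)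
  qed
  have ev: "\<forall>\<^sub>F t in nhds t0. v1 t > 0 \<and> v2 t > 0"
  proof (intro eventually_conj)
    show "\<forall>\<^sub>F t in nhds t0. v1 t > 0"
      using orbitD(7)[OF o1, of t0] pos
      by (auto simp: isCont_def tendsto_at_iff_tendsto_nhds dest: order_tendstoD)
    show "\<forall>\<^sub>F t in nhds t0. v2 t > 0"
      using orbitD(7)[OF o2, of t0] pos init
      by (auto simp: isCont_def tendsto_at_iff_tendsto_nhds dest: order_tendstoD)
  qed
  then obtain d where d: "d > 0" "\<And>t. dist t t0 < d \<Longrightarrow> v1 t > 0 \<and> v2 t > 0"
    by (auto simp: eventually_nhds_metric)
  have key: "w t \<in> {-m<..<m} \<and> (w has_real_derivative h (w t)) (at t)
      \<and> v t = V (\<xi> + \<bar>w t\<bar> powr q / q)"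
    if "orbit \<xi> v w" "v t > 0" for v w t
  proof -
    have eq: "\<xi> + \<bar>w t\<bar> powr q / q = W (v t)"
      using orbitD(4)[OF that(1), of t] kinw by simp
    have "W (v t) < W0"
      using W_strict_antimono[of 0 "v t"] that orbitD(6)[OF that(1)] W_0 by auto
    then have "\<bar>w t\<bar> < m" using m eq by simp
    moreover have "V (W (v t)) = v t" using V[of "v t"] that orbitD(6)[OF that(1)] by auto
    ultimately show ?thesis
      using orbitD(3)[OF that(1), of t] eq by (auto simp: h_def)
  qed
  have "v1 t = v2 t \<and> w1 t = w2 t" if "\<bar>t - t0\<bar> < d" for t
  proof -
    have "w1 t = w2 t"
    proof (rule autonomous_scalar_ode_unique[OF h_cont h_nz, of "ball t0 d" t0 t])
      show "w1 s \<in> {-m<..<m} \<and> (w1 has_real_derivative h (w1 s)) (at s)" if "s \<in> ball t0 d" for s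
        using key[OF o1, of s] d(2)[of s] that by (auto simp: dist_commute)
      show "w2 s \<in> {-m<..<m} \<and> (w2 has_real_derivative h (w2 s)) (at s)" if "s \<in> ball t0 d" for s
        using key[OF o2, of s] d(2)[of s] that by (auto simp: dist_commute)
    qed (use that d init in \<open>auto simp: dist_real_def\<close>)
    with key[OF o1, of t] key[OF o2, of t] d(2)[of t] that show ?thesis
      by (auto simp: dist_real_def)
  qed
  with d(1) show ?thesis by blast
qed

text \<open>At the top of the barrier the velocity does not vanish; there \<open>v\<close> itself solves a scalar
  autonomous equation.\<close>

lemma orbit_unique_near_zero:
  assumes o1: "orbit \<xi> v1 w1" and o2: "orbit \<xi> v2 w2" and \<xi>: "\<xi> < W0"
    and init: "v1 t0 = v2 t0" "w1 t0 = w2 t0" and zero: "v1 t0 = 0"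
  shows "\<exists>d>0. \<forall>t. \<bar>t - t0\<bar> < d \<longrightarrow> v1 t = v2 t \<and> w1 t = w2 t"
proof -
  define q where "q = conj_exp p"
  have q: "q > 1" using conj_gt_1 by (simp add: q_def)
  define \<sigma> where "\<sigma> = sgn (w1 t0)"
  define g where "g x = (q * (W x - \<xi>)) powr (1 / p)" for x
  have kin_inv: "\<bar>s\<bar> = (q * kin p s) powr (1 / p)" for s
    using p q by (simp add: kin_def powr_powr flip: q_def)
  have w_nz: "w1 t0 \<noteq> 0"
    using orbitD(4)[OF o1, of t0] zero W_0 \<xi> kin_phi_conj_eq_0_iff[OF p, of "w1 t0"] by auto
  have "isCont W 0" using W_at[of 0] by (auto intro: DERIV_isCont)
  then have "\<forall>\<^sub>F x in nhds 0. \<xi> < W x"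
    using \<xi> W_0 by (auto simp: isCont_def tendsto_at_iff_tendsto_nhds dest: order_tendstoD)
  then obtain e0 where e0: "e0 > 0" "\<And>x. dist x 0 < e0 \<Longrightarrow> \<xi> < W x"
    by (auto simp: eventually_nhds_metric)
  define e where "e = min e0 1"
  have e: "e > 0" "e \<le> 1" "\<And>x. x \<in> {-e<..<e} \<Longrightarrow> \<xi> < W x"
    using e0 by (auto simp: e_def dist_real_def)
  have g_cont: "continuous_on {-e<..<e} (\<lambda>x. \<sigma> * g x)"
    unfolding g_def using p e q
    by (intro continuous_intros continuous_on_powr' continuous_on_subset[OF W_cont])
      (auto intro: less_imp_le)
  have g_nz: "\<sigma> * g x \<noteq> 0" if "x \<in> {-e<..<e}" for x
    using e(3)[OF that] w_nz q by (simp add: g_def \<sigma>_def sgn_0_0)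
  have loc: "\<forall>\<^sub>F t in nhds t0. v t \<in> {-e<..<e} \<and> sgn (w t) = \<sigma>"
    if "orbit \<xi> v w" "v t0 = 0" "w t0 = w1 t0" for v w
  proof -
    have "\<forall>\<^sub>F t in nhds t0. v t \<in> {-e<..<e}"
    proof -
      have "(v \<longlongrightarrow> v t0) (nhds t0)"
        using orbitD(7)[OF that(1), of t0] by (simp add: isCont_def tendsto_at_iff_tendsto_nhds)
      then show ?thesis
        by (rule topological_tendstoD) (use that(2) e(1) in auto)
    qed
    moreover have "\<forall>\<^sub>F t in nhds t0. sgn (w t) = \<sigma>"
    proof -
      have "(w \<longlongrightarrow> w t0) (nhds t0)"
        using orbitD(8)[OF that(1), of t0] by (simp add: isCont_def tendsto_at_iff_tendsto_nhds)
      then have lim: "(w \<longlongrightarrow> w1 t0) (nhds t0)"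
        using that(3) by simp
      show ?thesis
      proof (cases "w1 t0 > 0")
        case True
        then show ?thesis using order_tendstoD(1)[OF lim True]
          by (auto simp: \<sigma>_def elim: eventually_mono)
      next
        case False
        then have "w1 t0 < 0" using w_nz by simp
        then show ?thesis using order_tendstoD(2)[OF lim, of 0]
          by (auto simp: \<sigma>_def elim: eventually_mono)
      qed
    qed
    ultimately show ?thesis by (rule eventually_conj)
  qed
  have "\<forall>\<^sub>F t in nhds t0. (v1 t \<in> {-e<..<e} \<and> sgn (w1 t) = \<sigma>) \<and> (v2 t \<in> {-e<..<e} \<and> sgn (w2 t) = \<sigma>)"
    using init zero by (intro eventually_conj loc o1 o2) auto
  then obtain d where d: "d > 0" "\<And>t. dist t t0 < d \<Longrightarrow>
      (v1 t \<in> {-e<..<e} \<and> sgn (w1 t) = \<sigma>) \<and> (v2 t \<in> {-e<..<e} \<and> sgn (w2 t) = \<sigma>)"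
    by (auto simp: eventually_nhds_metric)
  have key: "\<psi> (w t) = \<sigma> * g (v t)" if "orbit \<xi> v w" "sgn (w t) = \<sigma>" for v w t
  proof -
    have "\<bar>\<psi> (w t)\<bar> = g (v t)"
      using kin_inv[of "\<psi> (w t)"] orbitD(4)[OF that(1), of t] by (simp add: g_def)
    moreover have "sgn (\<psi> (w t)) = \<sigma>" using that(2) by simp
    ultimately show ?thesis by (metis sgn_mult_abs)
  qed
  have "v1 t = v2 t \<and> w1 t = w2 t" if t: "\<bar>t - t0\<bar> < d" for t
  proof -
    have "v1 t = v2 t"
    proof (rule autonomous_scalar_ode_unique[OF g_cont g_nz, of "ball t0 d" t0 t])
      show "v1 s \<in> {-e<..<e} \<and> (v1 has_real_derivative \<sigma> * g (v1 s)) (at s)" if "s \<in> ball t0 d" for s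
        using key[OF o1, of s] orbitD(2)[OF o1, of s] d(2)[of s] that by (auto simp: dist_commute)
      show "v2 s \<in> {-e<..<e} \<and> (v2 has_real_derivative \<sigma> * g (v2 s)) (at s)" if "s \<in> ball t0 d" for s
        using key[OF o2, of s] orbitD(2)[OF o2, of s] d(2)[of s] that by (auto simp: dist_commute)
    qed (use t d init in \<open>auto simp: dist_real_def\<close>)
    moreover have "\<psi> (w1 t) = \<psi> (w2 t)"
      using key[OF o1, of t] key[OF o2, of t] d(2)[of t] t calculation by (auto simp: dist_real_def)
    then have "w1 t = w2 t" using phi_phi_conj[OF p] by metis
    ultimately show ?thesis by simp
  qed
  with d(1) show ?thesis by blast
qed

text \<open>The times at which two orbits agree form a closed set, which is open by the two local
  statements (and the first one reflected).\<close>

lemma orbit_unique: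
  assumes o1: "orbit \<xi> v1 w1" and o2: "orbit \<xi> v2 w2" and \<xi>: "0 < \<xi>" "\<xi> < W0"
    and init: "v1 0 = v2 0" "w1 0 = w2 0"
  shows "v1 = v2" "w1 = w2"
proof -
  define A where "A = {t. v1 t = v2 t \<and> w1 t = w2 t}"
  have near: "\<exists>d>0. \<forall>t. \<bar>t - t0\<bar> < d \<longrightarrow> v1 t = v2 t \<and> w1 t = w2 t"
    if "t0 \<in> A" for t0
  proof -
    have i: "v1 t0 = v2 t0" "w1 t0 = w2 t0" using that by (auto simp: A_def)
    consider "v1 t0 > 0" | "v1 t0 = 0" | "v1 t0 < 0" by linarith
    then show ?thesis
    proof cases
      case 1 then show ?thesis using orbit_unique_near_pos[OF o1 o2 \<xi>(1) i] by simp
    next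
      case 2 then show ?thesis using orbit_unique_near_zero[OF o1 o2 \<xi>(2) i] by simp
    next
      case 3
      show ?thesis
        using double_well.orbit_unique_near_pos[OF reflected orbit_reflect[OF o1]
            orbit_reflect[OF o2] \<xi>(1), of t0] i 3 by simp
    qed
  qed
  have "open A"
    unfolding open_dist
  proof
    fix t0 assume "t0 \<in> A"
    from near[OF this] show "\<exists>e>0. \<forall>y. dist y t0 < e \<longrightarrow> y \<in> A"
      by (auto simp: A_def dist_real_def)
  qed
  moreover have "closed A"
    unfolding A_def using orbit_continuous_on[OF o1] orbit_continuous_on[OF o2]
    by (intro closed_Collect_conj closed_Collect_eq) auto
  moreover have "0 \<in> A" using init by (simp add: A_def)
  ultimately have "A = UNIV" using clopen[of A] by blast
  then show "v1 = v2" "w1 = w2" by (auto simp: A_def)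
qed

lemma W_pos: "-1 < x \<Longrightarrow> x < 1 \<Longrightarrow> W x > 0"
  using W_strict_antimono[of x 1] W_ends
    double_well.W_strict_antimono[OF reflected, of "- x" 1]
  by (cases "x \<ge> 0") auto

lemma kin_inv: "\<bar>s\<bar> = (conj_exp p * kin p s) powr (1 / p)"
  using p conj_gt_1 by (simp add: kin_def powr_powr)

lemma abs_velocity_le:
  assumes "kin p s \<le> c" shows "\<bar>s\<bar> \<le> (conj_exp p * c) powr (1 / p)"
proof -
  have "conj_exp p * kin p s \<le> conj_exp p * c"
    using conj_gt_1 assms by (intro mult_left_mono) auto
  then have "(conj_exp p * kin p s) powr (1 / p) \<le> (conj_exp p * c) powr (1 / p)"
    using conj_gt_1 p kin_nonneg[OF p, of s] by (intro powr_mono2) auto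
  then show ?thesis using kin_inv[of s] by simp
qed

text \<open>As long as \<open>v > 0\<close>, the force is negative and the momentum decreases. Once it is negative, \<open>v\<close>
  decreases at a definite rate. If it were never negative, \<open>v\<close> would increase and stay in a compact
  subset of \<open>(0, 1)\<close>, where the force is bounded away from zero, so the momentum would become
  negative after all.\<close>

lemma orbit_leaves_right_well:
  assumes o: "orbit \<xi> v w" and \<xi>: "0 < \<xi>"
  shows "\<exists>s\<ge>t1. v s \<le> 0"
proof (rule ccontr)
  assume "\<not> ?thesis"
  then have pos: "\<And>s. s \<ge> t1 \<Longrightarrow> v s > 0" by force
  have lt1: "v s < 1" for s
    using orbit_energy_le[OF o, of s] orbitD(6)[OF o, of s] \<xi> W_ends by (cases "v s = 1") auto
  have Dneg: "D (v s) < 0" if "s \<ge> t1" for s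
    using D_neg pos[OF that] lt1 by blast
  show False
  proof (cases "\<exists>t2\<ge>t1. w t2 < 0")
    case True
    then obtain t2 where t2: "t2 \<ge> t1" "w t2 < 0" by blast
    have w_le: "w s \<le> w t2" if "s \<ge> t2" for s
      using increment_le_of_derivative_le[OF that orbitD(3)[OF o], of 0] Dneg t2 
      by (force intro: less_imp_le)
    define c where "c = - \<psi> (w t2)"
    have c: "c > 0" using t2 by (simp add: c_def)
    have "v (t2 + 1 / c) - v t2 \<le> - c * (t2 + 1 / c - t2)"
    proof (rule increment_le_of_derivative_le[OF _ orbitD(2)[OF o]])
      show "\<psi> (w x) \<le> - c" if "t2 \<le> x" for x
        using phi_mono[OF conj_gt_1 w_le[OF that]] by (simp add: c_def)
    qed (use c in auto)
    also have "\<dots> = - 1" using c by simp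
    finally show False
      using pos[of "t2 + 1 / c"] lt1[of t2] c t2 by (smt (verit) divide_pos_pos)
  next
    case False
    then have w_nonneg: "\<And>s. s \<ge> t1 \<Longrightarrow> w s \<ge> 0" by force
    have v_ge: "v s \<ge> v t1" if "s \<ge> t1" for s
    proof -
      have "- v s - - v t1 \<le> 0 * (s - t1)"
      proof (rule increment_le_of_derivative_le[OF that])
        show "((\<lambda>s. - v s) has_real_derivative - \<psi> (w x)) (at x)" for x
          by (rule DERIV_minus[OF orbitD(2)[OF o]])
        show "- \<psi> (w x) \<le> 0" if "t1 \<le> x" for x
          using phi_mono[OF conj_gt_1 w_nonneg[OF that]] phi_eq_0_iff[of "conj_exp p" 0] by linarith
      qed
      then show ?thesis by simp
    qed
    define S where "S = {x \<in> {v t1..1}. \<xi> \<le> W x}"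
    have "compact S"
    proof -
      have "closed ({v t1..1} \<inter> W -` {\<xi>..})"
        by (rule continuous_closed_preimage)
          (use orbitD(5)[OF o, of t1] in \<open>auto intro: continuous_on_subset[OF W_cont]\<close>)
      moreover have "{v t1..1} \<inter> W -` {\<xi>..} = S" by (auto simp: S_def)
      ultimately have "closed S" by simp
      moreover have "bounded S" by (rule bounded_subset[of "{v t1..1}"]) (auto simp: S_def)
      ultimately show ?thesis by (simp add: compact_eq_bounded_closed)
    qed
    moreover have vS: "v s \<in> S" if "s \<ge> t1" for s
      using v_ge[OF that] orbitD(6)[OF o, of s] orbit_energy_le[OF o, of s] by (auto simp: S_def)
    moreover have "continuous_on S D"
      by (rule continuous_on_subset[OF D_cont]) (use orbitD(5)[OF o, of t1] in \<open>auto simp: S_def\<close>)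
    ultimately obtain x where x: "x \<in> S" "\<And>y. y \<in> S \<Longrightarrow> D y \<le> D x"
      using continuous_attains_sup[of S D] by blast
    define c where "c = - D x"
    have "x < 1" using x(1) W_ends \<xi> by (cases "x = 1") (auto simp: S_def)
    then have c: "c > 0" using D_neg[of x] x(1) pos[of t1] by (auto simp: S_def c_def)
    \<comment> \<open>by this time a force of modulus at least \<open>c\<close> has used up the momentum \<open>w t1\<close>\<close>
    define s where "s = t1 + (w t1 + 1) / c"
    have s: "s \<ge> t1" using w_nonneg[of t1] c by (simp add: s_def)
    have "w s - w t1 \<le> - c * (s - t1)"
      by (rule increment_le_of_derivative_le[OF s orbitD(3)[OF o]]) (use x vS in \<open>auto simp: c_def\<close>)
    also have "\<dots> = - (w t1 + 1)" using c by (simp add: s_def)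
    finally show False using w_nonneg[OF s] by simp
  qed
qed

lemma orbit_leaves_left_well:
  assumes o: "orbit \<xi> v w" and \<xi>: "0 < \<xi>"
  shows "\<exists>s\<ge>t1. v s \<ge> 0"
  using double_well.orbit_leaves_right_well[OF reflected orbit_reflect[OF o] \<xi>, of t1] by auto

text \<open>The orbit visits both wells again and again; the first zero after a time with \<open>v < 0\<close> is a
  crossing in the upward direction because the momentum does not vanish at zeros of \<open>v\<close>.\<close>

lemma orbit_crosses_upwards:
  assumes o: "orbit \<xi> v w" and \<xi>: "0 < \<xi>" "\<xi> < W0"
  shows "\<exists>s\<ge>t1. v s = 0 \<and> w s > 0"
proof -
  have w_nz: "w s \<noteq> 0" if "v s = 0" for s
    using orbitD(4)[OF o, of s] that W_0 \<xi> kin_phi_conj_eq_0_iff[OF p, of "w s"] by auto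
  obtain s1 where s1: "s1 \<ge> t1" "v s1 \<le> 0" using orbit_leaves_right_well[OF o \<xi>(1)] by blast
  show ?thesis
  proof (cases "v s1 = 0 \<and> w s1 > 0")
    case True
    then show ?thesis using s1 by blast
  next
    case no: False
    have "\<exists>s3\<ge>t1. v s3 < 0"
    proof (cases "v s1 = 0")
      case True
      then have "w s1 < 0" using no w_nz[of s1] by auto
      then have "\<psi> (w s1) < 0" by simp
      from DERIV_neg_dec_right[OF orbitD(2)[OF o] this]
      obtain d where "d > 0" "\<And>h. h > 0 \<Longrightarrow> h < d \<Longrightarrow> v (s1 + h) < v s1" by blast
      then show ?thesis using True s1 by (intro exI[of _ "s1 + d / 2"]) auto
    qed (use s1 in force)
    then obtain s3 where s3: "s3 \<ge> t1" "v s3 < 0" by blast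
    obtain s2 where s2: "s2 \<ge> s3" "v s2 \<ge> 0" using orbit_leaves_left_well[OF o \<xi>(1)] by blast
    define Z where "Z = {t \<in> {s3..s2}. v t = 0}"
    have "\<exists>t. s3 \<le> t \<and> t \<le> s2 \<and> v t = 0"
      using s2 s3 orbit_continuous_on[OF o] by (intro IVT') auto
    then have "Z \<noteq> {}" by (auto simp: Z_def)
    moreover have "compact Z"
    proof -
      have "closed Z" unfolding Z_def
        by (rule continuous_closed_preimage_constant[OF orbit_continuous_on(1)[OF o]]) simp
      moreover have "bounded Z" by (rule bounded_subset[of "{s3..s2}"]) (auto simp: Z_def)
      ultimately show ?thesis by (simp add: compact_eq_bounded_closed)
    qed
    ultimately obtain z where z: "z \<in> Z" "\<And>y. y \<in> Z \<Longrightarrow> z \<le> y"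
      using compact_attains_inf[of Z] by metis
    have vneg: "v t < 0" if "s3 \<le> t" "t < z" for t
    proof (rule ccontr)
      assume "\<not> v t < 0"
      then have "\<exists>y. s3 \<le> y \<and> y \<le> t \<and> v y = 0"
        using s3 that orbit_continuous_on[OF o] by (intro IVT') auto
      then obtain y where "s3 \<le> y" "y \<le> t" "v y = 0" by blast
      then have "y \<in> Z" using that z(1) by (auto simp: Z_def)
      from z(2)[OF this] that \<open>y \<le> t\<close> show False by simp
    qed
    have vz: "v z = 0" and zs: "s3 < z"
      using z(1) s3 by (auto simp: Z_def less_le)
    have "\<not> w z < 0"
    proof
      assume "w z < 0"
      then have "\<psi> (w z) < 0" by simp
      from DERIV_neg_dec_left[OF orbitD(2)[OF o] this]
      obtain d where d: "d > 0" "\<And>h. h > 0 \<Longrightarrow> h < d \<Longrightarrow> v z < v (z - h)" by blast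
      define h where "h = min (d / 2) (z - s3)"
      have "h > 0" "h < d" "s3 \<le> z - h" "z - h < z" using d zs by (auto simp: h_def)
      with d(2)[of h] vneg[of "z - h"] vz show False by simp
    qed
    then have "w z > 0" using w_nz[OF vz] by linarith
    then show ?thesis using vz zs s3 by (intro exI[of _ z]) auto
  qed
qed

section \<open>Time averages over orbits\<close>

lemma D_eq_deriv_on: "x \<in> {-1..1} \<Longrightarrow> deriv_on {-1..1} W x = D x"
  by (rule deriv_on_eqI) (auto intro: W_deriv)

lemma orbit_autonomous_solution:
  assumes o: "orbit \<xi> v w" and init: "v 0 = 0" "w 0 > 0"
  shows "autonomous_solution p W \<xi> v"
proof -
  have v': "deriv_on UNIV v = (\<lambda>y. \<psi> (w y))"
    using deriv_on_UNIV_eqI[OF orbitD(2)[OF o]] by blast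
  have w': "deriv_on UNIV w = (\<lambda>y. D (v y))"
    using deriv_on_UNIV_eqI[OF orbitD(3)[OF o]] by blast
  have C1v: "C1_on UNIV v"
    unfolding C1_on_def v' using orbitD(2)[OF o] conj_gt_1 orbit_continuous_on[OF o]
    by (auto simp: differentiable_on_def real_differentiable_def intro!: continuous_intros)
  have C1w: "C1_on UNIV w"
    unfolding C1_on_def w' using orbitD(3)[OF o] orbitD(1)[OF o] orbit_continuous_on[OF o]
    by (auto simp: differentiable_on_def real_differentiable_def
        intro!: continuous_on_compose2[OF D_cont])
  show ?thesis
    unfolding autonomous_solution_def v' phi_phi_conj[OF p] w'
    using C1v C1w orbitD(1,4)[OF o] init D_eq_deriv_on[OF orbitD(1)[OF o]]
    by auto
qed

lemma autonomous_solution_orbit: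
  assumes "autonomous_solution p W \<xi> v"
  shows "orbit \<xi> v (\<lambda>y. phi p (deriv_on UNIV v y))" "v 0 = 0" "phi p (deriv_on UNIV v 0) > 0"
proof -
  have "range v \<subseteq> {-1..1}" using assms by (simp add: autonomous_solution_def)
  then have r: "v y \<in> {-1..1}" for y by blast
  have "- deriv_on UNIV (\<lambda>z. phi p (deriv_on UNIV v z)) y + D (v y) = 0" for y
    using assms D_eq_deriv_on[OF r] by (auto simp: autonomous_solution_def)
  then have eq: "deriv_on UNIV (\<lambda>z. phi p (deriv_on UNIV v z)) y = D (v y)" for y
    by (metis add.commute add_eq_0_iff2 minus_minus)
  have C1: "C1_on UNIV v" "C1_on UNIV (\<lambda>z. phi p (deriv_on UNIV v z))"
    using assms by (auto simp: autonomous_solution_def)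
  have en: "- kin p (deriv_on UNIV v y) + W (v y) = \<xi>" for y
    using assms by (auto simp: autonomous_solution_def)
  show "orbit \<xi> v (\<lambda>y. phi p (deriv_on UNIV v y))"
    unfolding orbit_def phi_conj_phi[OF p]
    using r C1_on_has_deriv_on[OF C1(1)] C1_on_has_deriv_on[OF C1(2)] eq en
    by (auto simp: algebra_simps)
  show "v 0 = 0" "phi p (deriv_on UNIV v 0) > 0"
    using assms by (auto simp: autonomous_solution_def)
qed

text \<open>At a zero of \<open>v\<close> the energy fixes the modulus of the momentum, so the normalisation \<open>v(0) = 0\<close>,
  \<open>v'(0) > 0\<close> determines the initial data.\<close>

lemma vbar_eq:
  assumes o: "orbit \<xi> v w" and \<xi>: "0 < \<xi>" "\<xi> < W0" and init: "v 0 = 0" "w 0 > 0"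
  shows "vbar p W \<xi> = v"
  unfolding vbar_def
proof (rule the_equality)
  show "autonomous_solution p W \<xi> v" by (rule orbit_autonomous_solution[OF o init])
next
  fix v' assume "autonomous_solution p W \<xi> v'"
  note a = autonomous_solution_orbit[OF this]
  have "\<bar>phi p (deriv_on UNIV v' 0)\<bar> = \<bar>w 0\<bar>"
    using orbitD(4)[OF o, of 0] orbitD(4)[OF a(1), of 0] a(2) init
    by (subst kin_phi_conj_eq_iff[OF p, symmetric]) simp
  then show "v' = v"
    using orbit_unique(1)[OF a(1) o \<xi>] a(2,3) init by auto
qed

text \<open>Every orbit of energy in \<open>(0, W0)\<close> is a translate of \<open>vbar\<close>, hence periodic with the
  same period; its time average over a long window differs from the average over one period by
  a boundary term.\<close>

lemma orbit_average_interior: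
  assumes \<xi>: "0 < \<xi>" "\<xi> < W0" and \<eta>: "\<eta> > 0"
  shows "\<exists>M>0. \<forall>v w. orbit \<xi> v w \<longrightarrow>
    \<bar>integral {0..M} (\<lambda>t. W (v t) - \<xi>) - M * K p W W0 \<xi>\<bar> \<le> \<eta> * M"
proof -
  define T where "T = min_period (vbar p W \<xi>)"
  define \<kappa> where "\<kappa> = K p W W0 \<xi>"
  define B where "B = W0 + \<bar>\<kappa>\<bar>"
  define M where "M = max 1 (B * T / \<eta>)"
  have M: "M > 0" "B * T \<le> \<eta> * M"
    using \<eta> by (auto simp: M_def max_def field_simps)
  have B: "B \<ge> 0" using W0_pos by (simp add: B_def)
  have "\<bar>integral {0..M} (\<lambda>t. W (v t) - \<xi>) - M * \<kappa>\<bar> \<le> \<eta> * M" if o: "orbit \<xi> v w" for v w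
  proof -
    obtain s where s: "v s = 0" "w s > 0" using orbit_crosses_upwards[OF o \<xi>] by blast
    define v0 where "v0 t = v (t + s)" for t
    define w0 where "w0 t = w (t + s)" for t
    have o0: "orbit \<xi> v0 w0" unfolding v0_def w0_def by (rule orbit_shift[OF o])
    have init0: "v0 0 = 0" "w0 0 > 0" using s by (auto simp: v0_def w0_def)
    have vb: "vbar p W \<xi> = v0" by (rule vbar_eq[OF o0 \<xi> init0])
    \<comment> \<open>the translate to the next upward crossing solves the same initial value problem\<close>
    obtain T0 where T0: "T0 \<ge> 1" "v0 T0 = 0" "w0 T0 > 0"
      using orbit_crosses_upwards[OF o0 \<xi>] by blast
    have per0: "v0 (y + T0) = v0 y" for y
      using vbar_eq[OF orbit_shift[OF o0, of T0] \<xi>] vb T0 by (auto dest: fun_cong[of _ _ y])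
    have nonconst: "\<exists>a b. v0 a \<noteq> v0 b"
    proof (rule ccontr)
      assume "\<not> ?thesis"
      then have "v0 = (\<lambda>_. v0 0)" by blast
      then have "(v0 has_real_derivative 0) (at 0)" by (metis DERIV_const)
      from DERIV_unique[OF this orbitD(2)[OF o0]] init0 show False by simp
    qed
    then have T: "T > 0" "\<And>y. v0 (y + T) = v0 y"
      using min_period_is_period[OF orbit_continuous_on(1)[OF o0], of T0] per0 T0
      unfolding T_def vb by auto
    have perv: "v (y + T) = v y" for y
      using T(2)[of "y - s"] by (simp add: v0_def algebra_simps)
    obtain F where F: "\<And>x. (F has_real_derivative W (v x) - \<xi>) (at x)"
      by (rule ex_antiderivative_UNIV[of "\<lambda>x. W (v x) - \<xi>"])
        (use orbitD(1)[OF o] orbit_continuous_on[OF o] in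
          \<open>auto intro!: continuous_intros continuous_on_compose2[OF W_cont]\<close>)
    have "integral {0..T} (\<lambda>y. kin p (deriv_on UNIV v0 y)) = integral {0..T} (\<lambda>y. W (v0 y) - \<xi>)"
      using deriv_on_UNIV_eqI[OF orbitD(2)[OF o0]] orbitD(4)[OF o0] by simp
    also have "\<dots> = F (T + s) - F (0 + s)"
    proof (rule integral_eq_antiderivative_diff)
      show "((\<lambda>y. F (y + s)) has_real_derivative W (v0 y) - \<xi>) (at y within {0..T})" for y
        using F[of "y + s"] by (simp add: v0_def DERIV_shift has_field_derivative_at_within)
    qed (use T in simp)
    finally have \<kappa>: "\<kappa> * T = F (T + s) - F s"
      using \<xi> T by (simp add: \<kappa>_def K_def vb Let_def T_def[unfolded vb, symmetric])
    have deriv0: "\<forall>z. ((\<lambda>z. F (z + T) - F z) has_real_derivative 0) (at z)"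
    proof
      fix z
      have "((\<lambda>z. F (z + T)) has_real_derivative W (v (z + T)) - \<xi>) (at z)"
        using F[of "z + T"] by (simp add: DERIV_shift)
      from DERIV_diff[OF this F[of z]] show "((\<lambda>z. F (z + T) - F z) has_real_derivative 0) (at z)"
        by (simp add: perv)
    qed
    have const: "F (z + T) - F z = \<kappa> * T" for z
      using DERIV_isconst_all[OF deriv0, of z s] \<kappa> by (simp add: add.commute)
    \<comment> \<open>removing the mean from the antiderivative of the kinetic energy makes it periodic\<close>
    define G where "G z = F z - \<kappa> * z" for z
    have G_deriv: "(G has_real_derivative W (v x) - \<xi> - \<kappa>) (at x)" for x
      unfolding G_def by (auto intro!: derivative_eq_intros F)
    have bd: "\<bar>W (v x) - \<xi> - \<kappa>\<bar> \<le> B" for x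
      using W_bounds[OF orbitD(1)[OF o, of x]] \<xi> orbit_energy_le[OF o, of x] by (auto simp: B_def)
    have "\<bar>G M - G 0\<bar> \<le> 0 * (M - 0) + B * T"
    proof (rule increment_le_of_windows)
      show "\<bar>G (z + T) - G z\<bar> \<le> 0 * T" for z
        using const[of z] by (simp add: G_def algebra_simps)
      show "\<bar>G y - G x\<bar> \<le> B * (y - x)" if "x \<le> y" for x y
      proof -
        have "G y - G x \<le> B * (y - x)"
          by (rule increment_le_of_derivative_le[OF that G_deriv]) (use bd in \<open>auto simp: abs_le_iff\<close>)
        moreover have "- G y - - G x \<le> B * (y - x)"
          by (rule increment_le_of_derivative_le[OF that DERIV_minus[OF G_deriv]])
            (use bd in \<open>auto simp: abs_le_iff\<close>)
        ultimately show ?thesis by (simp add: abs_le_iff)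
      qed
    qed (use T M B in auto)
    then have "\<bar>F M - F 0 - M * \<kappa>\<bar> \<le> \<eta> * M"
      using M(2) by (simp add: G_def algebra_simps)
    moreover have "integral {0..M} (\<lambda>t. W (v t) - \<xi>) = F M - F 0"
      by (rule integral_eq_antiderivative_diff)
        (use M F in \<open>auto intro: has_field_derivative_at_within\<close>)
    ultimately show ?thesis by simp
  qed
  then show ?thesis using M(1) unfolding \<kappa>_def by blast
qed

text \<open>Near its minimum \<open>1\<close> the potential is at most \<open>C (1 - v)\<^sup>p\<close>, so at energy \<open>0\<close> the speed is
  at most a multiple of \<open>1 - v\<close> and, by Gronwall, the equilibrium is not reached in finite
  time.\<close>

lemma zero_energy_orbit_stays_at_1:
  assumes o: "orbit 0 v w" and t0: "v t0 = 1"
  shows "v t = 1"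
proof -
  define k where "k = (conj_exp p * C) powr (1 / p)"
  have C: "C > 0" using W_right[of 0] W_0 W0_pos by simp
  have speed: "\<bar>\<psi> (w s)\<bar> \<le> k * (1 - v s)" for s
  proof -
    have "kin p (\<psi> (w s)) \<le> C * (1 - v s) powr p"
      using orbitD(4)[OF o, of s] W_right[OF orbitD(1)[OF o, of s]] by simp
    from abs_velocity_le[OF this] have "\<bar>\<psi> (w s)\<bar> \<le> (conj_exp p * (C * (1 - v s) powr p)) powr (1 / p)" .
    also have "\<dots> = k * (1 - v s)"
      using C p conj_gt_1 orbitD(6)[OF o, of s] by (simp add: k_def powr_mult powr_powr)
    finally show ?thesis .
  qed
  have "1 - v t \<le> 0"
  proof (cases "t \<ge> t0")
    case True
    have "(1 - v t) * exp (- k * t) - (1 - v t0) * exp (- k * t0) \<le> 0 * (t - t0)"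
    proof (rule increment_le_of_derivative_le[OF True])
      fix s
      show "((\<lambda>s. (1 - v s) * exp (- k * s)) has_real_derivative
          (- \<psi> (w s) - k * (1 - v s)) * exp (- k * s)) (at s)"
        by (auto intro!: derivative_eq_intros orbitD(2)[OF o] simp: algebra_simps)
      show "(- \<psi> (w s) - k * (1 - v s)) * exp (- k * s) \<le> 0"
        using speed[of s] by (intro mult_nonpos_nonneg) auto
    qed
    then have "(1 - v t) * exp (- k * t) \<le> 0" using t0 by simp
    then show ?thesis by (simp add: mult_le_0_iff)
  next
    case False
    then have le: "t \<le> t0" by simp
    have "- ((1 - v t0) * exp (k * t0)) - - ((1 - v t) * exp (k * t)) \<le> 0 * (t0 - t)"
    proof (rule increment_le_of_derivative_le[OF le])
      fix s
      show "((\<lambda>s. - ((1 - v s) * exp (k * s))) has_real_derivative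
          (\<psi> (w s) - k * (1 - v s)) * exp (k * s)) (at s)"
        by (auto intro!: derivative_eq_intros orbitD(2)[OF o] simp: algebra_simps)
      show "(\<psi> (w s) - k * (1 - v s)) * exp (k * s) \<le> 0"
        using speed[of s] by (intro mult_nonpos_nonneg) auto
    qed
    then have "(1 - v t) * exp (k * t) \<le> 0" using t0 by simp
    then show ?thesis by (simp add: mult_le_0_iff)
  qed
  then show ?thesis using orbitD(6)[OF o, of t] by simp
qed

text \<open>Hence an orbit of energy \<open>0\<close> is constant or monotone, and its total kinetic action is
  bounded by a multiple of its total variation.\<close>

lemma zero_energy_action_le:
  assumes o: "orbit 0 v w" and M: "M \<ge> 0"
  defines "B \<equiv> (conj_exp p * W0) powr ((p - 1) / p) / conj_exp p"
  shows "\<bar>integral {0..M} (\<lambda>t. W (v t))\<bar> \<le> 2 * B"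
proof (cases "\<exists>t0. w t0 = 0")
  case True
  then obtain t0 where t0: "w t0 = 0" by blast
  then have "W (v t0) = 0" using orbitD(4)[OF o, of t0] by (simp add: kin_def)
  then have "v t0 = 1 \<or> v t0 = - 1"
    using W_pos[of "v t0"] orbitD(5,6)[OF o, of t0] by force
  then have "(\<forall>t. v t = 1) \<or> (\<forall>t. v t = - 1)"
    using zero_energy_orbit_stays_at_1[OF o]
      double_well.zero_energy_orbit_stays_at_1[OF reflected orbit_reflect[OF o]]
    by (metis minus_minus)
  then have "W (v t) = 0" for t using W_ends by auto
  then show ?thesis using conj_gt_1 by (simp add: B_def)
next
  case False
  define \<sigma> where "\<sigma> = sgn (w 0)"
  have \<sigma>: "\<bar>\<sigma>\<bar> = 1" using False by (simp add: \<sigma>_def abs_sgn_eq)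
  have sgn: "sgn (w t) = \<sigma>" for t
    unfolding \<sigma>_def by (rule constant_sgn) (use False orbit_continuous_on[OF o] in auto)
  have B: "B \<ge> 0" using conj_gt_1 by (simp add: B_def)
  have le: "W (v t) \<le> B * \<sigma> * \<psi> (w t)" for t
  proof -
    define s where "s = \<psi> (w t)"
    have kin: "kin p s = W (v t)" using orbitD(4)[OF o, of t] by (simp add: s_def)
    have "\<bar>s\<bar> \<le> (conj_exp p * W0) powr (1 / p)"
      using W_bounds[OF orbitD(1)[OF o, of t]] kin by (intro abs_velocity_le) simp
    then have "\<bar>s\<bar> powr (p - 1) \<le> ((conj_exp p * W0) powr (1 / p)) powr (p - 1)"
      using p by (intro powr_mono2) auto
    also have "\<dots> = B * conj_exp p" using conj_gt_1 by (simp add: B_def powr_powr)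
    finally have "\<bar>s\<bar> powr (p - 1) / conj_exp p \<le> B"
      using conj_gt_1 by (simp add: field_simps)
    moreover have "kin p s = \<bar>s\<bar> powr (p - 1) / conj_exp p * \<bar>s\<bar>"
      using powr_add[of "\<bar>s\<bar>" "p - 1" 1] by (cases "s = 0") (simp_all add: kin_def)
    ultimately have "kin p s \<le> B * \<bar>s\<bar>"
      by (metis mult_right_mono abs_ge_zero)
    moreover have "\<bar>s\<bar> = \<sigma> * s"
      using sgn[of t] by (metis s_def sgn_phi abs_sgn mult.commute)
    ultimately show ?thesis using kin by (simp add: s_def)
  qed
  have "integral {0..M} (\<lambda>t. W (v t)) \<le> integral {0..M} (\<lambda>t. B * \<sigma> * \<psi> (w t))"
  proof (rule integral_le)
    show "(\<lambda>t. W (v t)) integrable_on {0..M}"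
      by (intro integrable_continuous_interval continuous_on_compose2[OF W_cont]
          orbit_continuous_on[OF o]) (use orbitD(1)[OF o] in auto)
    show "(\<lambda>t. B * \<sigma> * \<psi> (w t)) integrable_on {0..M}"
      by (intro integrable_continuous_interval continuous_intros conj_gt_1 orbit_continuous_on[OF o])
  qed (rule le)
  also have "\<dots> = B * \<sigma> * v M - B * \<sigma> * v 0"
    by (rule integral_eq_antiderivative_diff[OF M])
      (intro DERIV_cmult has_field_derivative_at_within[OF orbitD(2)[OF o]])
  also have "\<dots> = B * (\<sigma> * (v M - v 0))" by (simp add: algebra_simps)
  also have "\<dots> \<le> B * 2"
  proof (intro mult_left_mono B)
    have "\<sigma> * (v M - v 0) \<le> \<bar>\<sigma>\<bar> * \<bar>v M - v 0\<bar>" by (metis abs_ge_self abs_mult)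
    also have "\<dots> \<le> 2" using \<sigma> orbitD(5,6)[OF o, of M] orbitD(5,6)[OF o, of 0] by simp
    finally show "\<sigma> * (v M - v 0) \<le> 2" .
  qed
  finally have "integral {0..M} (\<lambda>t. W (v t)) \<le> 2 * B" by simp
  moreover have "integral {0..M} (\<lambda>t. W (v t)) \<ge> 0"
  proof (rule integral_nonneg)
    show "(\<lambda>t. W (v t)) integrable_on {0..M}"
      by (intro integrable_continuous_interval continuous_on_compose2[OF W_cont]
          orbit_continuous_on[OF o]) (use orbitD(1)[OF o] in auto)
  qed (use W_bounds[OF orbitD(1)[OF o]] in auto)
  ultimately show ?thesis by simp
qed

text \<open>At negative energy the speed is bounded away from zero, so the orbit would leave \<open>[-1, 1]\<close>
  within a bounded time.\<close>

lemma orbit_energy_range: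
  assumes o: "orbit \<xi> v w"
  shows "\<xi> \<in> {0..W0}"
proof -
  have "\<xi> \<le> W0"
    using orbit_energy_le[OF o, of 0] W_bounds[OF orbitD(1)[OF o, of 0]] by simp
  moreover have "0 \<le> \<xi>"
  proof (rule ccontr)
    assume neg: "\<not> 0 \<le> \<xi>"
    define c where "c = (conj_exp p * (- \<xi>)) powr (1 / p)"
    have c: "c > 0" using neg conj_gt_1 by (simp add: c_def mult_pos_neg)
    have speed: "\<bar>\<psi> (w t)\<bar> \<ge> c" for t
    proof -
      have "conj_exp p * - \<xi> \<le> conj_exp p * kin p (\<psi> (w t))"
        using orbitD(4)[OF o, of t] W_bounds[OF orbitD(1)[OF o, of t]] conj_gt_1
        by (intro mult_left_mono) auto
      then have "c \<le> (conj_exp p * kin p (\<psi> (w t))) powr (1 / p)"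
        unfolding c_def using neg conj_gt_1 p by (intro powr_mono2) (auto simp: mult_nonneg_nonpos)
      then show ?thesis using kin_inv by simp
    qed
    define \<sigma> where "\<sigma> = sgn (w 0)"
    have nz: "w t \<noteq> 0" for t using speed[of t] c by auto
    have sgn: "sgn (w t) = \<sigma>" for t
      unfolding \<sigma>_def by (rule constant_sgn) (use nz orbit_continuous_on[OF o] in auto)
    \<comment> \<open>at speed at least \<open>c\<close> the distance covered up to time \<open>3 / c\<close> exceeds the diameter \<open>2\<close>\<close>
    have "- \<sigma> * v (3 / c) - - \<sigma> * v 0 \<le> - c * (3 / c - 0)"
    proof (rule increment_le_of_derivative_le)
      show "((\<lambda>t. - \<sigma> * v t) has_real_derivative - \<sigma> * \<psi> (w t)) (at t)" for t
        by (rule DERIV_cmult[OF orbitD(2)[OF o]])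
      have "\<sigma> * \<psi> (w t) = \<bar>\<psi> (w t)\<bar>" for t
        using sgn[of t] by (metis sgn_phi abs_sgn mult.commute)
      then show "- \<sigma> * \<psi> (w t) \<le> - c" for t using speed[of t] by simp
    qed (use c in simp)
    then have "\<sigma> * (v (3 / c) - v 0) \<ge> 3" using c by (simp add: algebra_simps)
    moreover have "\<bar>\<sigma>\<bar> = 1" using nz[of 0] by (simp add: \<sigma>_def abs_sgn_eq)
    ultimately show False
      using orbitD(5,6)[OF o, of "3 / c"] orbitD(5,6)[OF o, of 0]
      by (cases "\<sigma> \<ge> 0") (auto simp: abs_if split: if_splits)
  qed
  ultimately show ?thesis by simp
qed

text \<open>One window length \<open>M\<close> serves all orbits of the given energy: this uniformity is what the
  compactness argument for the solutions requires.\<close>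

lemma orbit_average:
  assumes \<xi>: "\<xi> \<in> {0..W0}" and \<eta>: "\<eta> > 0"
  shows "\<exists>M>0. \<forall>v w. orbit \<xi> v w \<longrightarrow>
    \<bar>integral {0..M} (\<lambda>t. W (v t) - \<xi>) - M * K p W W0 \<xi>\<bar> \<le> \<eta> * M"
proof -
  consider "\<xi> = 0" | "0 < \<xi>" "\<xi> < W0" | "\<xi> = W0" using \<xi> by force
  then show ?thesis
  proof cases
    case 1
    define B where "B = (conj_exp p * W0) powr ((p - 1) / p) / conj_exp p"
    define M where "M = max 1 (2 * B / \<eta>)"
    have M: "M > 0" "2 * B \<le> \<eta> * M"
      using \<eta> by (auto simp: M_def max_def field_simps)
    have "\<bar>integral {0..M} (\<lambda>t. W (v t) - \<xi>) - M * K p W W0 \<xi>\<bar> \<le> \<eta> * M"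
      if "orbit \<xi> v w" for v w
      using zero_energy_action_le[of v w M] that M 1 by (simp add: B_def[symmetric] K_def)
    with M(1) show ?thesis by blast
  next
    case 2
    then show ?thesis by (rule orbit_average_interior[OF _ _ \<eta>])
  next
    case 3
    have "W (v t) - \<xi> = 0" if o: "orbit \<xi> v w" for v w t
      using orbit_energy_le[OF o, of t] W_bounds[OF orbitD(1)[OF o, of t]] 3 by simp
    then show ?thesis using 3 \<eta> by (intro exI[of _ 1]) (auto simp: K_def)
  qed
qed

end

section \<open>Blow-up of the solutions\<close>

text \<open>Constant extension of the solutions beyond \<open>[0, 1]\<close>. It makes the rescaled solutions
  equi-Lipschitz on the whole line, although they solve the equation only on intervals that
  exhaust the line.\<close>

definition clamp01 :: "real \<Rightarrow> real" where
  "clamp01 x = max 0 (min 1 x)"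

lemma clamp01_range [simp]: "clamp01 x \<in> {0..1}" "0 \<le> clamp01 x" "clamp01 x \<le> 1"
  by (auto simp: clamp01_def)

lemma clamp01_id [simp]: "x \<in> {0..1} \<Longrightarrow> clamp01 x = x"
  by (auto simp: clamp01_def)

lemma clamp01_lipschitz: "\<bar>clamp01 x - clamp01 y\<bar> \<le> \<bar>x - y\<bar>"
  by (auto simp: clamp01_def)

lemma continuous_on_clamp01 [continuous_intros]:
  "continuous_on S f \<Longrightarrow> continuous_on S (\<lambda>x. clamp01 (f x))"
  unfolding clamp01_def by (intro continuous_intros)

lemma has_real_derivative_rescaled:
  assumes f: "(f has_real_derivative d) (at (z + k * y) within {0..1})"
    and y: "y \<in> {s..t}" and sub: "\<And>y. y \<in> {s..t} \<Longrightarrow> z + k * y \<in> {0..1}"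
  shows "((\<lambda>y. f (clamp01 (z + k * y))) has_real_derivative d * k) (at y within {s..t})"
proof -
  have "(f has_real_derivative d) (at (z + k * y) within (\<lambda>y. z + k * y) ` {s..t})"
    by (rule DERIV_subset[OF f]) (use sub in auto)
  moreover have "((\<lambda>y. z + k * y) has_real_derivative k) (at y within {s..t})"
    by (auto intro!: derivative_eq_intros)
  ultimately have "((\<lambda>y. f (z + k * y)) has_real_derivative d * k) (at y within {s..t})"
    using DERIV_image_chain by (fastforce simp: o_def)
  then show ?thesis
    by (rule has_field_derivative_transform_within[OF _ zero_less_one y])
      (use sub in auto)
qed

text \<open>The solutions as first-order systems, with momentum \<open>w n = \<phi>\<^sub>p(\<epsilon>\<^sub>n u\<^sub>n')\<close> and energy \<open>e n\<close>.
  The bound \<open>Q\<close> on the energies bounds the momenta uniformly.\<close>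

locale singular_family = double_well +
  fixes a da :: "real \<Rightarrow> real" and \<epsilon> :: "nat \<Rightarrow> real" and u w e :: "nat \<Rightarrow> real \<Rightarrow> real"
    and E :: "real \<Rightarrow> real" and Q :: real
  assumes a_deriv: "\<And>x. x \<in> {0..1} \<Longrightarrow> (a has_real_derivative da x) (at x within {0..1})"
    and da_cont: "continuous_on {0..1} da"
    and a_pos: "\<And>x. x \<in> {0..1} \<Longrightarrow> a x > 0"
    and eps_pos: "\<And>n. \<epsilon> n > 0" and eps_lim: "\<epsilon> \<longlonglongrightarrow> 0"
    and u_range: "\<And>n x. x \<in> {0..1} \<Longrightarrow> u n x \<in> {-1..1}"
    and u_deriv: "\<And>n x. x \<in> {0..1} \<Longrightarrow>
      (u n has_real_derivative \<psi> (w n x) / \<epsilon> n) (at x within {0..1})"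
    and w_deriv: "\<And>n x. x \<in> {0..1} \<Longrightarrow>
      (w n has_real_derivative a x * D (u n x) / \<epsilon> n) (at x within {0..1})"
    and e_eq: "\<And>n x. e n x = W (u n x) - kin p (\<psi> (w n x)) / a x"
    and e_lim: "uniform_limit {0..1} e E sequentially"
    and e_bound: "\<And>n x. x \<in> {0..1} \<Longrightarrow> \<bar>e n x\<bar> \<le> Q"
begin

lemma a_cont: "continuous_on {0..1} a"
  using a_deriv by (meson DERIV_continuous continuous_on_eq_continuous_within)

lemma u_cont: "continuous_on {0..1} (u n)"
  using u_deriv by (meson DERIV_continuous continuous_on_eq_continuous_within)

lemma w_cont: "continuous_on {0..1} (w n)"
  using w_deriv by (meson DERIV_continuous continuous_on_eq_continuous_within)

lemma kin_eq: "x \<in> {0..1} \<Longrightarrow> kin p (\<psi> (w n x)) = a x * (W (u n x) - e n x)"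
  using a_pos[of x] by (simp add: e_eq)

text \<open>Of the two terms of order \<open>1 / \<epsilon>\<close>, one comes from \<open>W(u)\<close> and one from the kinetic energy; they
  cancel by the equation, and what remains comes from the variation of \<open>a\<close>.\<close>

lemma energy_deriv:
  assumes x: "x \<in> {0..1}"
  shows "(e n has_real_derivative da x / a x * (W (u n x) - e n x)) (at x within {0..1})"
proof -
  have "(W has_real_derivative D (u n x)) (at (u n x) within u n ` {0..1})"
    by (rule DERIV_subset[OF W_deriv]) (use u_range x in auto)
  from DERIV_image_chain[OF this u_deriv[OF x]]
  have Wu: "((\<lambda>x. W (u n x)) has_real_derivative D (u n x) * (\<psi> (w n x) / \<epsilon> n)) (at x within {0..1})"
    by (simp add: o_def)
  have kw: "((\<lambda>x. kin p (\<psi> (w n x))) has_real_derivative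
      \<psi> (w n x) * (a x * D (u n x) / \<epsilon> n)) (at x within {0..1})"
    by (rule DERIV_chain2[OF has_real_derivative_kin_phi_conj[OF p] w_deriv[OF x]])
  have "((\<lambda>x. W (u n x) - kin p (\<psi> (w n x)) / a x) has_real_derivative
      D (u n x) * (\<psi> (w n x) / \<epsilon> n) -
      (\<psi> (w n x) * (a x * D (u n x) / \<epsilon> n) * a x - kin p (\<psi> (w n x)) * da x) / (a x * a x))
      (at x within {0..1})"
    using a_pos[OF x] by (intro DERIV_diff Wu DERIV_divide kw a_deriv x) auto
  moreover have "D (u n x) * (\<psi> (w n x) / \<epsilon> n) -
      (\<psi> (w n x) * (a x * D (u n x) / \<epsilon> n) * a x - kin p (\<psi> (w n x)) * da x) / (a x * a x)
      = da x / a x * (W (u n x) - e n x)"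
    using a_pos[OF x] eps_pos[of n] by (simp add: kin_eq[OF x] field_simps)
  moreover have "e n = (\<lambda>x. W (u n x) - kin p (\<psi> (w n x)) / a x)"
    using e_eq by blast
  ultimately show ?thesis by simp
qed

lemma e_cont: "continuous_on {0..1} (e n)"
  using energy_deriv by (meson DERIV_continuous continuous_on_eq_continuous_within)

lemma E_cont: "continuous_on {0..1} E"
  by (rule uniform_limit_theorem[OF _ e_lim]) (auto intro: always_eventually e_cont)

lemma e_tendsto: "x \<in> {0..1} \<Longrightarrow> (\<lambda>n. e n x) \<longlonglongrightarrow> E x"
  using tendsto_uniform_limitI[OF e_lim] by simp

lemma excess_bound:
  assumes "x \<in> {0..1}" shows "0 \<le> W (u n x) - e n x" "W (u n x) - e n x \<le> W0 + Q"
proof -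
  show "0 \<le> W (u n x) - e n x"
    using a_pos[OF assms] kin_nonneg[OF p, of "\<psi> (w n x)"] by (simp add: e_eq)
  show "W (u n x) - e n x \<le> W0 + Q"
    using W_bounds[OF u_range[OF assms, of n]] e_bound[OF assms, of n] by auto
qed

lemma momentum_bound:
  obtains S where "S > 0" "\<And>n x. x \<in> {0..1} \<Longrightarrow> \<bar>\<psi> (w n x)\<bar> \<le> S"
    "\<And>n x. x \<in> {0..1} \<Longrightarrow> \<bar>w n x\<bar> \<le> S"
proof -
  obtain A where A: "A > 0" "\<And>x. x \<in> {0..1} \<Longrightarrow> \<bar>a x\<bar> \<le> A"
    using bounded_of_continuous[OF a_cont] by blast
  define s where "s = (conj_exp p * (A * (W0 + Q))) powr (1 / p)"
  have 1: "\<bar>\<psi> (w n x)\<bar> \<le> s" if x: "x \<in> {0..1}" for n x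
    unfolding s_def
  proof (rule abs_velocity_le)
    show "kin p (\<psi> (w n x)) \<le> A * (W0 + Q)"
      unfolding kin_eq[OF x] using A(1) A(2)[OF x] excess_bound[OF x, of n] x a_pos[OF x]
      by (intro mult_mono) auto
  qed
  have 2: "\<bar>w n x\<bar> \<le> s powr (p - 1)" if x: "x \<in> {0..1}" for n x
  proof -
    have "\<bar>w n x\<bar> = \<bar>\<psi> (w n x)\<bar> powr (p - 1)"
      using abs_phi[of p "\<psi> (w n x)"] p by simp
    also have "\<dots> \<le> s powr (p - 1)" using 1[OF x] p by (intro powr_mono2) auto
    finally show ?thesis .
  qed
  define S where "S = s + s powr (p - 1) + 1"
  have "s \<ge> 0" by (simp add: s_def)
  then have S: "S > 0" "s \<le> S" "s powr (p - 1) \<le> S" by (auto simp: S_def add_nonneg_pos)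
  show thesis
    using S(1) order_trans[OF 1 S(2)] order_trans[OF 2 S(3)] by (rule that)
qed

lemma energy_lipschitz:
  obtains L where "L > 0"
    "\<And>n x y. x \<in> {0..1} \<Longrightarrow> y \<in> {0..1} \<Longrightarrow> \<bar>e n y - e n x\<bar> \<le> L * \<bar>y - x\<bar>"
proof -
  have "continuous_on {0..1} (\<lambda>x. da x / a x)"
    using a_pos by (intro continuous_intros da_cont a_cont) force
  then obtain B where B: "B > 0" "\<And>x. x \<in> {0..1} \<Longrightarrow> \<bar>da x / a x\<bar> \<le> B"
    using bounded_of_continuous by blast
  have Q: "W0 + Q > 0" using W0_pos e_bound[of 0 0] by simp
  have "norm (e n y - e n x) \<le> (B * (W0 + Q)) * norm (y - x)"
    if "x \<in> {0..1}" "y \<in> {0..1}" for n x y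
  proof (rule field_differentiable_bound[OF _ energy_deriv _ that(2,1)])
    fix z :: real assume z: "z \<in> {0..1}"
    show "norm (da z / a z * (W (u n z) - e n z)) \<le> B * (W0 + Q)"
      unfolding norm_mult using B excess_bound[OF z, of n] z by (intro mult_mono) auto
  qed auto
  then show thesis
    using B Q by (intro that[of "B * (W0 + Q)"]) auto
qed

end

text \<open>Centres of blow-up, kept at distance \<open>\<surd>\<epsilon>\<close> from the boundary: this is much larger than \<open>\<epsilon>\<close>, so
  in the magnified variable the domain exhausts the line, and it tends to zero, so the boundary
  layers that are left out do not count in the limit.\<close>

locale blowup_sequence = singular_family +
  fixes n :: "nat \<Rightarrow> nat" and z :: "nat \<Rightarrow> real" and x0 :: real
  assumes x0: "x0 \<in> {0..1}" and n_lim: "filterlim n at_top sequentially" and z_lim: "z \<longlonglongrightarrow> x0"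
    and deep: "\<And>j. sqrt (\<epsilon> (n j)) \<le> z j" "\<And>j. z j \<le> 1 - sqrt (\<epsilon> (n j))"
begin

text \<open>Since \<open>scale\<^sup>p a(x\<^sub>0) = 1\<close>, the rescaling turns the frozen coefficient into \<open>1\<close>.\<close>

definition scale :: real where "scale = a x0 powr (- 1 / p)"

definition point :: "nat \<Rightarrow> real \<Rightarrow> real" where
  "point j y = clamp01 (z j + \<epsilon> (n j) * scale * y)"

definition profile :: "nat \<Rightarrow> real \<Rightarrow> real" where
  "profile j y = u (n j) (point j y)"

definition momentum :: "nat \<Rightarrow> real \<Rightarrow> real" where
  "momentum j y = scale powr (p - 1) * w (n j) (point j y)"

lemma scale_pos: "scale > 0"
  using a_pos[OF x0] by (simp add: scale_def)

lemma scale_powr: "scale powr p = 1 / a x0" "scale powr (p - 1) * scale = 1 / a x0"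
proof -
  show 1: "scale powr p = 1 / a x0"
  proof -
    have "scale powr p = a x0 powr (- 1)"
      using p by (simp add: scale_def powr_powr)
    also have "\<dots> = 1 / a x0"
      using a_pos[OF x0] by (simp add: powr_minus_divide)
    finally show ?thesis .
  qed
  have "scale powr (p - 1) * scale = scale powr p"
    using scale_pos powr_add[of scale "p - 1" 1] by simp
  with 1 show "scale powr (p - 1) * scale = 1 / a x0" by simp
qed

lemma point_range [simp]: "point j y \<in> {0..1}" "0 \<le> point j y" "point j y \<le> 1"
  by (simp_all add: point_def)

lemma eps_n_lim: "(\<lambda>j. \<epsilon> (n j)) \<longlonglongrightarrow> 0"
  by (rule filterlim_compose[OF eps_lim n_lim])

lemma point_tendsto: "(\<lambda>j. point j y) \<longlonglongrightarrow> x0"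
proof -
  have "(\<lambda>j. clamp01 (z j + \<epsilon> (n j) * scale * y)) \<longlonglongrightarrow> clamp01 (x0 + 0 * scale * y)"
    unfolding clamp01_def by (intro tendsto_intros z_lim eps_n_lim)
  then show ?thesis using x0 by (simp add: point_def)
qed

lemma point_lipschitz: "\<bar>point j y - point j y'\<bar> \<le> \<epsilon> (n j) * scale * \<bar>y - y'\<bar>"
proof -
  have "\<bar>point j y - point j y'\<bar> \<le> \<bar>(z j + \<epsilon> (n j) * scale * y) - (z j + \<epsilon> (n j) * scale * y')\<bar>"
    unfolding point_def by (rule clamp01_lipschitz)
  also have "\<dots> = \<bar>\<epsilon> (n j) * scale * (y - y')\<bar>" by (simp add: algebra_simps)
  also have "\<dots> = \<epsilon> (n j) * scale * \<bar>y - y'\<bar>"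
    using eps_pos[of "n j"] scale_pos by (simp add: abs_mult)
  finally show ?thesis .
qed

lemma point_cont: "continuous_on S (point j)"
  unfolding point_def by (intro continuous_intros)

lemma eventually_inside:
  "\<forall>\<^sub>F j in sequentially. \<forall>y\<in>{s..t}. z j + \<epsilon> (n j) * scale * y \<in> {0..1}"
proof -
  define R where "R = max \<bar>s\<bar> \<bar>t\<bar>"
  have "(\<lambda>j. sqrt (\<epsilon> (n j)) * (scale * R)) \<longlonglongrightarrow> sqrt 0 * (scale * R)"
    by (intro tendsto_intros eps_n_lim)
  then have "\<forall>\<^sub>F j in sequentially. sqrt (\<epsilon> (n j)) * (scale * R) < 1"
    by (intro order_tendstoD) auto
  then show ?thesis
  proof eventually_elim
    case (elim j)
    show ?case
    proof
      fix y assume y: "y \<in> {s..t}"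
      have "\<bar>\<epsilon> (n j) * scale * y\<bar> \<le> \<epsilon> (n j) * scale * R"
        using y eps_pos[of "n j"] scale_pos by (auto simp: abs_mult R_def intro!: mult_left_mono)
      also have "\<dots> = sqrt (\<epsilon> (n j)) * (sqrt (\<epsilon> (n j)) * (scale * R))"
        using eps_pos[of "n j"] by (simp add: mult.assoc[symmetric])
      also have "\<dots> \<le> sqrt (\<epsilon> (n j)) * 1"
        using elim eps_pos[of "n j"] by (intro mult_left_mono) auto
      finally show "z j + \<epsilon> (n j) * scale * y \<in> {0..1}"
        using deep[of j] by (auto simp: abs_le_iff)
    qed
  qed
qed

lemma profile_range: "profile j y \<in> {-1..1}"
  unfolding profile_def by (rule u_range) simp

lemma profile_cont: "continuous_on S (profile j)"
  unfolding profile_def by (intro continuous_on_compose2[OF u_cont] point_cont) auto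

lemma momentum_cont: "continuous_on S (momentum j)"
  unfolding momentum_def
  by (intro continuous_intros continuous_on_compose2[OF w_cont] point_cont) auto

lemma velocity_eq: "\<psi> (momentum j y) = scale * \<psi> (w (n j) (point j y))"
proof -
  have "\<psi> (momentum j y) = (scale powr (p - 1)) powr (conj_exp p - 1) * \<psi> (w (n j) (point j y))"
    unfolding momentum_def using scale_pos by (intro phi_scale) simp
  also have "(scale powr (p - 1)) powr (conj_exp p - 1) = scale"
    using scale_pos p by (simp add: powr_powr conj_exp_minus_1)
  finally show ?thesis .
qed

lemma kin_momentum:
  "kin p (\<psi> (momentum j y)) = a (point j y) / a x0 * (W (profile j y) - e (n j) (point j y))"
  unfolding velocity_eq kin_scale[OF scale_pos] scale_powr
  by (simp add: kin_eq profile_def)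

lemma profile_deriv:
  assumes "y \<in> {s..t}" "\<forall>y\<in>{s..t}. z j + \<epsilon> (n j) * scale * y \<in> {0..1}"
  shows "(profile j has_real_derivative \<psi> (momentum j y)) (at y within {s..t})"
proof -
  have eq: "point j y = z j + \<epsilon> (n j) * scale * y"
    using assms by (simp add: point_def)
  have "((\<lambda>y. u (n j) (clamp01 (z j + \<epsilon> (n j) * scale * y))) has_real_derivative
      \<psi> (w (n j) (z j + \<epsilon> (n j) * scale * y)) / \<epsilon> (n j) * (\<epsilon> (n j) * scale)) (at y within {s..t})"
    by (rule has_real_derivative_rescaled[OF u_deriv]) (use assms in auto)
  then show ?thesis
    unfolding profile_def[abs_def] velocity_eq unfolding eq unfolding point_def
    using eps_pos[of "n j"] by (simp add: mult.commute)
qed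

lemma momentum_deriv:
  assumes "y \<in> {s..t}" "\<forall>y\<in>{s..t}. z j + \<epsilon> (n j) * scale * y \<in> {0..1}"
  shows "(momentum j has_real_derivative a (point j y) / a x0 * D (profile j y)) (at y within {s..t})"
proof -
  have eq: "point j y = z j + \<epsilon> (n j) * scale * y"
    using assms by (simp add: point_def)
  have "((\<lambda>y. w (n j) (clamp01 (z j + \<epsilon> (n j) * scale * y))) has_real_derivative
      a (point j y) * D (profile j y) / \<epsilon> (n j) * (\<epsilon> (n j) * scale)) (at y within {s..t})"
    unfolding profile_def eq
    by (rule has_real_derivative_rescaled[OF w_deriv]) (use assms in auto)
  from DERIV_cmult[OF this, of "scale powr (p - 1)"]
  have "(momentum j has_real_derivative scale powr (p - 1) *
      (a (point j y) * D (profile j y) / \<epsilon> (n j) * (\<epsilon> (n j) * scale))) (at y within {s..t})"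
    by (simp add: momentum_def[abs_def] point_def)
  moreover have "scale powr (p - 1) *
      (a (point j y) * D (profile j y) / \<epsilon> (n j) * (\<epsilon> (n j) * scale))
      = (scale powr (p - 1) * scale) * (a (point j y) * D (profile j y))"
    using eps_pos[of "n j"] by simp
  ultimately show ?thesis by (simp add: scale_powr)
qed

lemma energy_point_tendsto: "(\<lambda>j. e (n j) (point j y)) \<longlonglongrightarrow> E x0"
  by (rule tendsto_uniform_limit_compose[OF e_lim E_cont n_lim point_tendsto x0]) simp

lemma a_point_tendsto: "(\<lambda>j. a (point j y)) \<longlonglongrightarrow> a x0"
  by (rule continuous_on_tendsto_compose[OF a_cont point_tendsto x0]) auto

lemma da_point_tendsto: "(\<lambda>j. da (point j y)) \<longlonglongrightarrow> da x0"
  by (rule continuous_on_tendsto_compose[OF da_cont point_tendsto x0]) auto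

text \<open>The derivatives of \<open>u\<close> and \<open>w\<close> are of order \<open>1 / \<epsilon>\<close>, which the magnification compensates.\<close>

lemma profile_momentum_equi_lipschitz:
  obtains B L where "\<And>j y. \<bar>profile j y\<bar> \<le> B" "\<And>j y. \<bar>momentum j y\<bar> \<le> B"
    "\<And>j x y. \<bar>profile j x - profile j y\<bar> \<le> L * \<bar>x - y\<bar>"
    "\<And>j x y. \<bar>momentum j x - momentum j y\<bar> \<le> L * \<bar>x - y\<bar>"
proof -
  obtain S where S: "S > 0" "\<And>n x. x \<in> {0..1} \<Longrightarrow> \<bar>\<psi> (w n x)\<bar> \<le> S"
    "\<And>n x. x \<in> {0..1} \<Longrightarrow> \<bar>w n x\<bar> \<le> S"
    using momentum_bound by blast
  obtain A where A: "A > 0" "\<And>x. x \<in> {0..1} \<Longrightarrow> \<bar>a x\<bar> \<le> A"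
    using bounded_of_continuous[OF a_cont] by blast
  obtain Dm where Dm: "Dm > 0" "\<And>x. x \<in> {-1..1} \<Longrightarrow> \<bar>D x\<bar> \<le> Dm"
    using bounded_of_continuous[OF D_cont] by blast
  define c where "c = scale powr (p - 1)"
  have c: "c \<ge> 0" by (simp add: c_def)
  have lip: "\<bar>f (point j x) - f (point j y)\<bar> \<le> k * scale * \<bar>x - y\<bar>"
    if k: "k \<ge> 0" and d: "\<And>x. x \<in> {0..1} \<Longrightarrow> (f has_real_derivative f' x / \<epsilon> (n j)) (at x within {0..1})"
      "\<And>x. x \<in> {0..1} \<Longrightarrow> \<bar>f' x\<bar> \<le> k" for f f' j k x y
  proof -
    have "norm (f (point j x) - f (point j y)) \<le> k / \<epsilon> (n j) * norm (point j x - point j y)"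
    proof (rule field_differentiable_bound[OF _ d(1) _ point_range(1) point_range(1)])
      show "norm (f' x / \<epsilon> (n j)) \<le> k / \<epsilon> (n j)" if "x \<in> {0..1}" for x
        using d(2)[OF that] eps_pos[of "n j"] by (simp add: divide_right_mono)
    qed auto
    also have "\<dots> \<le> k / \<epsilon> (n j) * (\<epsilon> (n j) * scale * \<bar>x - y\<bar>)"
      using point_lipschitz k eps_pos[of "n j"] by (intro mult_left_mono) auto
    also have "\<dots> = k * scale * \<bar>x - y\<bar>" using eps_pos[of "n j"] by simp
    finally show ?thesis by simp
  qed
  define L where "L = S * scale + c * (A * Dm * scale)"
  have L: "S * scale \<le> L" "c * (A * Dm * scale) \<le> L"
    using S(1) A(1) Dm(1) scale_pos c by (auto simp: L_def)
  show thesis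
  proof (rule that[of "1 + c * S" L])
    show "\<bar>profile j y\<bar> \<le> 1 + c * S" for j y
      using profile_range[of j y] c S(1) by (smt (verit) atLeastAtMost_iff mult_nonneg_nonneg)
    have mom: "\<bar>momentum j y\<bar> \<le> c * S" for j y
      using S(3)[OF point_range(1)] c by (auto simp: momentum_def abs_mult c_def intro!: mult_left_mono)
    show "\<bar>momentum j y\<bar> \<le> 1 + c * S" for j y using mom[of j y] by simp
    show "\<bar>profile j x - profile j y\<bar> \<le> L * \<bar>x - y\<bar>" for j x y
    proof -
      have "\<bar>profile j x - profile j y\<bar> \<le> S * scale * \<bar>x - y\<bar>"
        unfolding profile_def using S by (intro lip[OF _ u_deriv]) auto
      also have "\<dots> \<le> L * \<bar>x - y\<bar>" using L by (intro mult_right_mono) auto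
      finally show ?thesis .
    qed
    show "\<bar>momentum j x - momentum j y\<bar> \<le> L * \<bar>x - y\<bar>" for j x y
    proof -
      have "\<bar>w (n j) (point j x) - w (n j) (point j y)\<bar> \<le> A * Dm * scale * \<bar>x - y\<bar>"
      proof (rule lip[OF _ w_deriv])
        show "\<bar>a x * D (u (n j) x)\<bar> \<le> A * Dm" if "x \<in> {0..1}" for x
          unfolding abs_mult using A Dm u_range that by (intro mult_mono) auto
      qed (use A Dm in auto)
      then have "c * \<bar>w (n j) (point j x) - w (n j) (point j y)\<bar> \<le> c * (A * Dm * scale * \<bar>x - y\<bar>)"
        by (intro mult_left_mono c)
      moreover have "\<bar>momentum j x - momentum j y\<bar> = c * \<bar>w (n j) (point j x) - w (n j) (point j y)\<bar>"
        using c by (simp add: momentum_def c_def abs_mult flip: right_diff_distrib)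
      moreover have "c * (A * Dm * scale) * \<bar>x - y\<bar> \<le> L * \<bar>x - y\<bar>"
        using L by (intro mult_right_mono) auto
      ultimately show ?thesis by (simp add: mult.assoc)
    qed
  qed
qed

text \<open>Both equations and the energy identity pass to the limit, because the coefficient \<open>a\<close> and the
  energy at the moving points converge to their values at \<open>x\<^sub>0\<close>.\<close>

context
  fixes v wl :: "real \<Rightarrow> real"
  assumes v_lim: "\<And>y. (\<lambda>j. profile j y) \<longlonglongrightarrow> v y"
    and wl_lim: "\<And>y. (\<lambda>j. momentum j y) \<longlonglongrightarrow> wl y"
begin

lemma limit_range: "v y \<in> {-1..1}"
  using closed_sequentially[OF closed_atLeastAtMost _ v_lim] profile_range by blast

lemma limit_W: "(\<lambda>j. W (profile j y)) \<longlonglongrightarrow> W (v y)"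
  by (rule continuous_on_tendsto_compose[OF W_cont v_lim limit_range])
    (use profile_range in auto)

lemma limit_cont: "continuous_on UNIV v" "continuous_on UNIV wl"
proof -
  obtain B L where BL: "\<And>j y. \<bar>profile j y\<bar> \<le> B" "\<And>j y. \<bar>momentum j y\<bar> \<le> B"
    "\<And>j x y. \<bar>profile j x - profile j y\<bar> \<le> L * \<bar>x - y\<bar>"
    "\<And>j x y. \<bar>momentum j x - momentum j y\<bar> \<le> L * \<bar>x - y\<bar>"
    using profile_momentum_equi_lipschitz by blast
  show "continuous_on UNIV v" "continuous_on UNIV wl"
    using continuous_on_limit_equi_lipschitz[OF v_lim BL(3)]
      continuous_on_limit_equi_lipschitz[OF wl_lim BL(4)] by auto
qed

lemma limit_orbit: "orbit (E x0) v wl"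
  unfolding orbit_def
proof (intro allI conjI)
  fix t
  obtain B L where BL: "\<And>j y. \<bar>profile j y\<bar> \<le> B" "\<And>j y. \<bar>momentum j y\<bar> \<le> B"
    "\<And>j x y. \<bar>profile j x - profile j y\<bar> \<le> L * \<bar>x - y\<bar>"
    "\<And>j x y. \<bar>momentum j x - momentum j y\<bar> \<le> L * \<bar>x - y\<bar>"
    using profile_momentum_equi_lipschitz by blast
  have \<psi>_lim: "(\<lambda>j. \<psi> (momentum j y)) \<longlonglongrightarrow> \<psi> (wl y)" for y
    by (rule isCont_tendsto_compose[OF isCont_phi[OF conj_gt_1] wl_lim])
  show "v t \<in> {-1..1}" by (rule limit_range)
  obtain S where S: "S > 0" "\<And>n x. x \<in> {0..1} \<Longrightarrow> \<bar>\<psi> (w n x)\<bar> \<le> S"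
    using momentum_bound by metis
  show "(v has_real_derivative \<psi> (wl t)) (at t)"
  proof (rule bounded_limit_has_derivative)
    show "\<forall>\<^sub>F j in sequentially. \<forall>y\<in>{s..t}.
        (profile j has_real_derivative \<psi> (momentum j y)) (at y within {s..t})" for s t
      using eventually_inside[of s t] by eventually_elim (auto intro: profile_deriv)
    show "continuous_on UNIV (\<lambda>y. \<psi> (momentum j y))" for j
      by (intro continuous_intros conj_gt_1 momentum_cont)
    show "continuous_on UNIV (\<lambda>y. \<psi> (wl y))"
      by (intro continuous_intros conj_gt_1 limit_cont)
    show "\<bar>\<psi> (momentum j y)\<bar> \<le> scale * S" for j y
      using S(2)[OF point_range(1)] scale_pos by (simp add: velocity_eq abs_mult)
  qed (rule v_lim \<psi>_lim)+
  obtain A where A: "A > 0" "\<And>x. x \<in> {0..1} \<Longrightarrow> \<bar>a x\<bar> \<le> A"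
    using bounded_of_continuous[OF a_cont] by blast
  obtain Dm where Dm: "Dm > 0" "\<And>x. x \<in> {-1..1} \<Longrightarrow> \<bar>D x\<bar> \<le> Dm"
    using bounded_of_continuous[OF D_cont] by blast
  have a0: "a x0 > 0" by (rule a_pos[OF x0])
  show "(wl has_real_derivative D (v t)) (at t)"
  proof (rule bounded_limit_has_derivative)
    show "\<forall>\<^sub>F j in sequentially. \<forall>y\<in>{s..t}.
        (momentum j has_real_derivative a (point j y) / a x0 * D (profile j y)) (at y within {s..t})" for s t
      using eventually_inside[of s t] by eventually_elim (intro ballI, rule momentum_deriv)
    show "continuous_on UNIV (\<lambda>y. a (point j y) / a x0 * D (profile j y))" for j
      using a0 profile_range by (intro continuous_intros continuous_on_compose2[OF a_cont]
          continuous_on_compose2[OF D_cont] point_cont profile_cont) auto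
    show "continuous_on UNIV (\<lambda>y. D (v y))"
      using limit_range by (intro continuous_on_compose2[OF D_cont] limit_cont) auto
    show "\<bar>a (point j y) / a x0 * D (profile j y)\<bar> \<le> A / a x0 * Dm" for j y
      unfolding abs_mult using A Dm a0 profile_range
      by (intro mult_mono) (auto simp: divide_right_mono)
    show "(\<lambda>j. a (point j y) / a x0 * D (profile j y)) \<longlonglongrightarrow> D (v y)" for y
    proof -
      have "(\<lambda>j. D (profile j y)) \<longlonglongrightarrow> D (v y)"
        by (rule continuous_on_tendsto_compose[OF D_cont v_lim limit_range])
          (use profile_range in auto)
      then have "(\<lambda>j. a (point j y) / a x0 * D (profile j y)) \<longlonglongrightarrow> a x0 / a x0 * D (v y)"
        using a0 by (intro tendsto_intros a_point_tendsto) auto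
      then show ?thesis using a0 by simp
    qed
  qed (rule wl_lim)
  have "(\<lambda>j. a (point j t) / a x0 * (W (profile j t) - e (n j) (point j t)))
      \<longlonglongrightarrow> a x0 / a x0 * (W (v t) - E x0)"
    using a0 by (intro tendsto_intros a_point_tendsto limit_W energy_point_tendsto) auto
  then have 1: "(\<lambda>j. kin p (\<psi> (momentum j t))) \<longlonglongrightarrow> W (v t) - E x0"
    using a0 by (simp add: kin_momentum)
  have "isCont (kin p) (\<psi> (wl t))"
    using continuous_on_kin[OF p continuous_on_id, of UNIV]
    by (simp add: continuous_on_eq_continuous_at)
  from isCont_tendsto_compose[OF this \<psi>_lim]
  have 2: "(\<lambda>j. kin p (\<psi> (momentum j t))) \<longlonglongrightarrow> kin p (\<psi> (wl t))" .
  show "kin p (\<psi> (wl t)) = W (v t) - E x0" by (rule LIMSEQ_unique[OF 2 1])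
qed

text \<open>Integrating \<open>energy_deriv\<close> over a window and magnifying yields the average that is controlled by
  \<open>orbit_average\<close>.\<close>

lemma limit_energy_increment:
  assumes M: "M > 0"
  shows "(\<lambda>j. (e (n j) (z j + \<epsilon> (n j) * scale * M) - e (n j) (z j)) / (\<epsilon> (n j) * scale))
    \<longlonglongrightarrow> da x0 / a x0 * integral {0..M} (\<lambda>t. W (v t) - E x0)"
proof -
  define f where "f j y = da (point j y) / a (point j y) * (W (profile j y) - e (n j) (point j y))" for j y
  have quot: "continuous_on {0..1} (\<lambda>x. da x / a x)"
    using a_pos by (intro continuous_intros da_cont a_cont) force
  obtain B where B: "B > 0" "\<And>x. x \<in> {0..1} \<Longrightarrow> \<bar>da x / a x\<bar> \<le> B"
    using bounded_of_continuous[OF quot] by blast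
  have "(\<lambda>j. integral {0..M} (f j)) \<longlonglongrightarrow> integral {0..M} (\<lambda>t. da x0 / a x0 * (W (v t) - E x0))"
  proof (rule bounded_limit_integral)
    show "continuous_on {0..M} (f j)" for j
      unfolding f_def using profile_range
      by (intro continuous_on_mult continuous_on_diff continuous_on_compose2[OF quot]
          continuous_on_compose2[OF W_cont] continuous_on_compose2[OF e_cont] point_cont profile_cont) auto
    show "\<bar>f j y\<bar> \<le> B * (W0 + Q)" for j y
      unfolding f_def abs_mult
      using B(1) B(2)[of "point j y"] excess_bound[of "point j y" "n j"]
      by (intro mult_mono) (auto simp: profile_def)
    show "(\<lambda>j. f j y) \<longlonglongrightarrow> da x0 / a x0 * (W (v y) - E x0)" for y
      unfolding f_def using a_pos[OF x0]
      by (intro tendsto_intros a_point_tendsto da_point_tendsto limit_W energy_point_tendsto) auto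
  qed
  moreover have "\<forall>\<^sub>F j in sequentially. integral {0..M} (f j) =
      (e (n j) (z j + \<epsilon> (n j) * scale * M) - e (n j) (z j)) / (\<epsilon> (n j) * scale)"
    using eventually_inside[of 0 M]
  proof eventually_elim
    case (elim j)
    have k: "\<epsilon> (n j) * scale > 0" using eps_pos[of "n j"] scale_pos by simp
    define G where "G y = e (n j) (clamp01 (z j + \<epsilon> (n j) * scale * y)) / (\<epsilon> (n j) * scale)" for y
    have "integral {0..M} (f j) = G M - G 0"
    proof (rule integral_eq_antiderivative_diff)
      fix y assume y: "y \<in> {0..M}"
      have eq: "point j y = z j + \<epsilon> (n j) * scale * y"
        using y elim by (simp add: point_def)
      have "((\<lambda>y. e (n j) (clamp01 (z j + \<epsilon> (n j) * scale * y))) has_real_derivative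
          f j y * (\<epsilon> (n j) * scale)) (at y within {0..M})"
        unfolding f_def profile_def eq
        by (rule has_real_derivative_rescaled[OF energy_deriv]) (use y elim in auto)
      from DERIV_cdivide[OF this, of "\<epsilon> (n j) * scale"]
      show "(G has_real_derivative f j y) (at y within {0..M})"
        using eps_pos[of "n j"] scale_pos by (simp add: G_def[abs_def])
    qed (use M in simp)
    also have "\<dots> = (e (n j) (z j + \<epsilon> (n j) * scale * M) - e (n j) (z j)) / (\<epsilon> (n j) * scale)"
      using elim M by (auto simp: G_def diff_divide_distrib dest: bspec[of _ _ 0] bspec[of _ _ M])
    finally show ?case .
  qed
  ultimately show ?thesis
    using tendsto_cong by (fastforce simp: integral_mult_right)
qed

end

end

lemma (in blowup_sequence) blowup_subsequence:
  assumes r: "strict_mono r"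
  shows "blowup_sequence p W D W0 C a da \<epsilon> u w e E Q (\<lambda>j. n (r j)) (\<lambda>j. z (r j)) x0"
proof
  show "filterlim (\<lambda>j. n (r j)) at_top sequentially"
    by (rule filterlim_compose[OF n_lim filterlim_subseq[OF r]])
  show "(\<lambda>j. z (r j)) \<longlonglongrightarrow> x0"
    using LIMSEQ_subseq_LIMSEQ[OF z_lim r] by (simp add: o_def)
qed (use x0 deep in auto)

lemma (in blowup_sequence) ex_blowup_limit:
  obtains r v wl where "strict_mono (r :: nat \<Rightarrow> nat)" "orbit (E x0) v wl"
    "\<And>M. M > 0 \<Longrightarrow> (\<lambda>j. (e (n (r j)) (z (r j) + \<epsilon> (n (r j)) * scale * M) - e (n (r j)) (z (r j)))
        / (\<epsilon> (n (r j)) * scale))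
      \<longlonglongrightarrow> da x0 / a x0 * integral {0..M} (\<lambda>t. W (v t) - E x0)"
proof -
  obtain B L where BL: "\<And>j y. \<bar>profile j y\<bar> \<le> B" "\<And>j y. \<bar>momentum j y\<bar> \<le> B"
    "\<And>j x y. \<bar>profile j x - profile j y\<bar> \<le> L * \<bar>x - y\<bar>"
    "\<And>j x y. \<bar>momentum j x - momentum j y\<bar> \<le> L * \<bar>x - y\<bar>"
    using profile_momentum_equi_lipschitz by blast
  obtain r1 v where r1: "strict_mono (r1 :: nat \<Rightarrow> nat)" "\<And>y. (\<lambda>j. profile (r1 j) y) \<longlonglongrightarrow> v y"
    using equi_lipschitz_subsequence[of profile B L] BL(1,3) by blast
  obtain r2 wl where r2: "strict_mono (r2 :: nat \<Rightarrow> nat)"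
    "\<And>y. (\<lambda>j. momentum (r1 (r2 j)) y) \<longlonglongrightarrow> wl y"
    using equi_lipschitz_subsequence[of "\<lambda>j. momentum (r1 j)" B L] BL(2,4) by blast
  define r where "r j = r1 (r2 j)" for j
  have r: "strict_mono r" using r1(1) r2(1) by (simp add: strict_mono_def r_def)
  interpret sub: blowup_sequence p W D W0 C a da \<epsilon> u w e E Q "\<lambda>j. n (r j)" "\<lambda>j. z (r j)" x0
    by (rule blowup_subsequence[OF r])
  have eqs: "sub.profile j = profile (r j)" "sub.momentum j = momentum (r j)" for j
    by (auto simp: sub.profile_def sub.momentum_def sub.point_def profile_def momentum_def point_def
        fun_eq_iff)
  have v: "(\<lambda>j. sub.profile j y) \<longlonglongrightarrow> v y" for y
  proof -
    have "(\<lambda>j. profile (r j) y) \<longlonglongrightarrow> v y"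
      using LIMSEQ_subseq_LIMSEQ[OF r1(2) r2(1)] by (simp add: o_def r_def)
    then show ?thesis by (simp only: eqs)
  qed
  have wl: "(\<lambda>j. sub.momentum j y) \<longlonglongrightarrow> wl y" for y
  proof -
    have "(\<lambda>j. momentum (r j) y) \<longlonglongrightarrow> wl y"
      using r2(2) by (simp add: r_def)
    then show ?thesis by (simp only: eqs)
  qed
  show thesis
    by (rule that[OF r sub.limit_orbit[OF v wl] sub.limit_energy_increment[OF v wl]])
qed

section \<open>The limit energy\<close>

text \<open>Blowing up at \<open>x\<^sub>0\<close> itself, pushed slightly inside at the end points, yields an orbit of energy
  \<open>E(x\<^sub>0)\<close>.\<close>

lemma (in singular_family) limit_energy_range:
  assumes x0: "x0 \<in> {0..1}"
  shows "E x0 \<in> {0..W0}"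
proof -
  have "(\<lambda>n. sqrt (\<epsilon> n)) \<longlonglongrightarrow> sqrt 0" by (intro tendsto_intros eps_lim)
  then have "\<forall>\<^sub>F n in sequentially. sqrt (\<epsilon> n) < 1 / 2"
    by (intro order_tendstoD) auto
  then obtain N where N: "\<And>n. n \<ge> N \<Longrightarrow> sqrt (\<epsilon> n) < 1 / 2"
    by (auto simp: eventually_sequentially)
  define n where "n j = j + N" for j :: nat
  have n_lim: "filterlim n at_top sequentially"
    unfolding n_def by (rule filterlim_add_const_nat_at_top)
  define z where "z j = max (sqrt (\<epsilon> (n j))) (min (1 - sqrt (\<epsilon> (n j))) x0)" for j
  have "(\<lambda>j. sqrt (\<epsilon> (n j))) \<longlonglongrightarrow> 0"
    using filterlim_compose[OF \<open>(\<lambda>n. sqrt (\<epsilon> n)) \<longlonglongrightarrow> sqrt 0\<close> n_lim] by simp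
  then have "z \<longlonglongrightarrow> max 0 (min (1 - 0) x0)"
    unfolding z_def by (intro tendsto_intros)
  then have z_lim: "z \<longlonglongrightarrow> x0" using x0 by simp
  interpret blowup_sequence p W D W0 C a da \<epsilon> u w e E Q n z x0
  proof
    show "sqrt (\<epsilon> (n j)) \<le> z j" "z j \<le> 1 - sqrt (\<epsilon> (n j))" for j
      using N[of "n j"] by (auto simp: z_def n_def)
  qed (use x0 n_lim z_lim in auto)
  show ?thesis
    using ex_blowup_limit orbit_energy_range by metis
qed

text \<open>If the claim failed for every \<open>\<delta>\<close> and \<open>N\<close>, the bad windows would converge to \<open>x\<^sub>0\<close>, and the
  blow-up along them would be an orbit whose average over \<open>[0, M]\<close> contradicts the choice of \<open>M\<close>.\<close>

lemma (in singular_family) window_increment: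
  assumes x0: "x0 \<in> {0..1}" and \<eta>: "\<eta> > 0"
  defines "s \<equiv> a x0 powr (- 1 / p)" and "\<kappa> \<equiv> da x0 / a x0 * K p W W0 (E x0)"
  obtains M \<delta> N where "M > 0" "\<delta> > 0"
    "\<And>n z. n \<ge> N \<Longrightarrow> \<bar>z - x0\<bar> < \<delta> \<Longrightarrow> sqrt (\<epsilon> n) \<le> z \<Longrightarrow> z \<le> 1 - sqrt (\<epsilon> n) \<Longrightarrow>
      \<bar>e n (z + \<epsilon> n * s * M) - e n z - \<kappa> * (\<epsilon> n * s * M)\<bar> \<le> \<eta> * (\<epsilon> n * s * M)"
proof -
  define b where "b = da x0 / a x0"
  \<comment> \<open>half of \<open>\<eta>\<close> is left for the convergence of the blow-up\<close>
  define \<eta>' where "\<eta>' = \<eta> / (2 * (\<bar>b\<bar> + 1))"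
  have \<eta>': "\<eta>' > 0" "\<bar>b\<bar> * \<eta>' < \<eta> / 2" using \<eta> by (auto simp: \<eta>'_def field_simps)
  obtain M where M: "M > 0" "\<And>v w. orbit (E x0) v w \<Longrightarrow>
      \<bar>integral {0..M} (\<lambda>t. W (v t) - E x0) - M * K p W W0 (E x0)\<bar> \<le> \<eta>' * M"
    using orbit_average[OF limit_energy_range[OF x0] \<eta>'(1)] by blast
  have s: "s > 0" using a_pos[OF x0] by (simp add: s_def)
  have "\<exists>\<delta>>0. \<exists>N. \<forall>n\<ge>N. \<forall>z. \<bar>z - x0\<bar> < \<delta> \<longrightarrow> sqrt (\<epsilon> n) \<le> z \<longrightarrow> z \<le> 1 - sqrt (\<epsilon> n) \<longrightarrow>
      \<bar>e n (z + \<epsilon> n * s * M) - e n z - \<kappa> * (\<epsilon> n * s * M)\<bar> \<le> \<eta> * (\<epsilon> n * s * M)"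
  proof (rule ccontr)
    assume no: "\<not> ?thesis"
    have "\<exists>n z. n \<ge> j \<and> \<bar>z - x0\<bar> < 1 / real (Suc j) \<and> sqrt (\<epsilon> n) \<le> z \<and> z \<le> 1 - sqrt (\<epsilon> n) \<and>
        \<bar>e n (z + \<epsilon> n * s * M) - e n z - \<kappa> * (\<epsilon> n * s * M)\<bar> > \<eta> * (\<epsilon> n * s * M)" for j :: nat
    proof -
      have "1 / real (Suc j) > 0" by simp
      with no show ?thesis by (meson not_less)
    qed
    then obtain n z where nz: "\<And>j. n j \<ge> j" "\<And>j. \<bar>z j - x0\<bar> < 1 / real (Suc j)"
      "\<And>j. sqrt (\<epsilon> (n j)) \<le> z j" "\<And>j. z j \<le> 1 - sqrt (\<epsilon> (n j))"
      "\<And>j. \<bar>e (n j) (z j + \<epsilon> (n j) * s * M) - e (n j) (z j) - \<kappa> * (\<epsilon> (n j) * s * M)\<bar>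
        > \<eta> * (\<epsilon> (n j) * s * M)"
      by metis
    have n_lim: "filterlim n at_top sequentially"
      using nz(1) by (intro filterlim_at_top_mono[OF filterlim_ident]) auto
    have z_lim: "z \<longlonglongrightarrow> x0"
    proof -
      have "(\<lambda>j. z j - x0) \<longlonglongrightarrow> 0"
        by (rule Lim_null_comparison[OF _ LIMSEQ_inverse_real_of_nat])
          (use nz(2) in \<open>auto intro!: always_eventually less_imp_le simp: inverse_eq_divide\<close>)
      then show ?thesis by (simp add: LIM_zero_iff)
    qed
    interpret blowup_sequence p W D W0 C a da \<epsilon> u w e E Q n z x0
      by standard (use x0 n_lim z_lim nz(3,4) in auto)
    have scale: "scale = s" by (simp add: scale_def s_def)
    obtain r v wl where r: "strict_mono (r :: nat \<Rightarrow> nat)" "orbit (E x0) v wl"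
      and lim: "\<And>M. M > 0 \<Longrightarrow> (\<lambda>j. (e (n (r j)) (z (r j) + \<epsilon> (n (r j)) * scale * M) - e (n (r j)) (z (r j)))
        / (\<epsilon> (n (r j)) * scale)) \<longlonglongrightarrow> da x0 / a x0 * integral {0..M} (\<lambda>t. W (v t) - E x0)"
      using ex_blowup_limit by blast
    define I where "I = integral {0..M} (\<lambda>t. W (v t) - E x0)"
    define q where "q j = (e (n (r j)) (z (r j) + \<epsilon> (n (r j)) * s * M) - e (n (r j)) (z (r j)))
        / (\<epsilon> (n (r j)) * s)" for j
    have "q \<longlonglongrightarrow> b * I" using lim[OF M(1)] by (simp add: q_def[abs_def] scale b_def I_def)
    then have "\<forall>\<^sub>F j in sequentially. dist (q j) (b * I) < \<eta> / 2 * M"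
      using \<eta> M(1) by (intro tendstoD) auto
    then obtain j where j: "\<bar>q j - b * I\<bar> < \<eta> / 2 * M"
      by (auto simp: eventually_sequentially dist_real_def)
    have "\<bar>b * I - \<kappa> * M\<bar> = \<bar>b\<bar> * \<bar>I - M * K p W W0 (E x0)\<bar>"
      by (simp add: \<kappa>_def b_def[symmetric] abs_mult[symmetric] algebra_simps)
    also have "\<dots> \<le> \<bar>b\<bar> * (\<eta>' * M)"
      using M(2)[OF r(2)] by (intro mult_left_mono) (auto simp: I_def)
    also have "\<dots> \<le> \<eta> / 2 * M"
      using \<eta>'(2) M(1) by (simp add: mult.assoc[symmetric] mult_right_mono)
    finally have "\<bar>b * I - \<kappa> * M\<bar> \<le> \<eta> / 2 * M" .
    moreover have "\<eta> / 2 * M + \<eta> / 2 * M = \<eta> * M" by simp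
    ultimately have qM: "\<bar>q j - \<kappa> * M\<bar> \<le> \<eta> * M" using j by linarith
    define k where "k = \<epsilon> (n (r j)) * s"
    have k: "k > 0" using eps_pos s by (simp add: k_def)
    have "\<bar>(q j - \<kappa> * M) * k\<bar> \<le> \<eta> * M * k"
      using qM k by (simp add: abs_mult mult_right_mono)
    moreover have "q j * k = e (n (r j)) (z (r j) + \<epsilon> (n (r j)) * s * M) - e (n (r j)) (z (r j))"
      using k unfolding q_def k_def by simp
    then have "(q j - \<kappa> * M) * k = e (n (r j)) (z (r j) + \<epsilon> (n (r j)) * s * M) - e (n (r j)) (z (r j))
        - \<kappa> * (\<epsilon> (n (r j)) * s * M)"
      by (simp add: left_diff_distrib) (simp add: k_def)
    ultimately show False
      using nz(5)[of "r j"] by (simp add: k_def algebra_simps)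
  qed
  then show thesis using M(1) that by blast
qed

text \<open>After removal of the predicted linear part, the increment of \<open>e n\<close> between two points near
  \<open>x\<^sub>0\<close> is estimated by tiling the interval shortened by \<open>\<surd>\<epsilon>\<^sub>n\<close> at both ends; the errors from the two
  ends and from the incomplete window vanish as \<open>n\<close> tends to infinity.\<close>

lemma (in singular_family) limit_energy_deriv:
  assumes x0: "x0 \<in> {0..1}"
  shows "(E has_real_derivative da x0 / a x0 * K p W W0 (E x0)) (at x0 within {0..1})"
proof -
  define \<kappa> where "\<kappa> = da x0 / a x0 * K p W W0 (E x0)"
  obtain L where L: "L > 0"
    "\<And>n x y. x \<in> {0..1} \<Longrightarrow> y \<in> {0..1} \<Longrightarrow> \<bar>e n y - e n x\<bar> \<le> L * \<bar>y - x\<bar>"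
    using energy_lipschitz by blast
  define B where "B = L + \<bar>\<kappa>\<bar>"
  have B: "B \<ge> 0" using L by (simp add: B_def)
  have key: "\<exists>\<delta>>0. \<forall>x\<in>{0..1}. \<forall>y\<in>{0..1}. x < y \<longrightarrow> \<bar>x - x0\<bar> < \<delta> \<longrightarrow> \<bar>y - x0\<bar> < \<delta> \<longrightarrow>
      \<bar>E y - E x - \<kappa> * (y - x)\<bar> \<le> \<eta> * (y - x)" if \<eta>: "\<eta> > 0" for \<eta>
  proof -
    define s where "s = a x0 powr (- 1 / p)"
    have s: "s > 0" using a_pos[OF x0] by (simp add: s_def)
    obtain M \<delta> N where M: "M > 0" and \<delta>: "\<delta> > 0" and win:
      "\<And>n z. n \<ge> N \<Longrightarrow> \<bar>z - x0\<bar> < \<delta> \<Longrightarrow> sqrt (\<epsilon> n) \<le> z \<Longrightarrow> z \<le> 1 - sqrt (\<epsilon> n) \<Longrightarrow>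
        \<bar>e n (z + \<epsilon> n * s * M) - e n z - \<kappa> * (\<epsilon> n * s * M)\<bar> \<le> \<eta> * (\<epsilon> n * s * M)"
      using window_increment[OF x0 \<eta>] unfolding s_def \<kappa>_def by blast
    have "\<bar>E y - E x - \<kappa> * (y - x)\<bar> \<le> \<eta> * (y - x)"
      if x: "x \<in> {0..1}" "\<bar>x - x0\<bar> < \<delta>" and y: "y \<in> {0..1}" "\<bar>y - x0\<bar> < \<delta>" and xy: "x < y" for x y
    proof -
      define g where "g n t = e n t - \<kappa> * t" for n t
      have g_lip: "\<bar>g n t' - g n t\<bar> \<le> B * (t' - t)" if "0 \<le> t" "t \<le> t'" "t' \<le> 1" for n t t'
      proof -
        have "\<bar>g n t' - g n t\<bar> = \<bar>(e n t' - e n t) - \<kappa> * (t' - t)\<bar>"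
          by (simp add: g_def algebra_simps)
        also have "\<dots> \<le> \<bar>e n t' - e n t\<bar> + \<bar>\<kappa> * (t' - t)\<bar>" by (rule abs_triangle_ineq4)
        also have "\<dots> \<le> L * (t' - t) + \<bar>\<kappa>\<bar> * (t' - t)"
          using L(2)[of t t' n] that by (simp add: abs_mult)
        finally show ?thesis by (simp add: B_def algebra_simps)
      qed
      have "(\<lambda>n. sqrt (\<epsilon> n)) \<longlonglongrightarrow> sqrt 0" by (intro tendsto_intros eps_lim)
      then have small: "\<forall>\<^sub>F n in sequentially. sqrt (\<epsilon> n) < (y - x) / 2"
        using xy by (intro order_tendstoD) auto
      have "\<forall>\<^sub>F n in sequentially. \<bar>g n y - g n x\<bar> \<le> \<eta> * (y - x) + B * (\<epsilon> n * s * M) + 2 * B * sqrt (\<epsilon> n)"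
        using small eventually_ge_at_top[of N]
      proof eventually_elim
        case (elim n)
        define c where "c = x + sqrt (\<epsilon> n)"
        define d where "d = y - sqrt (\<epsilon> n)"
        define h where "h = \<epsilon> n * s * M"
        have h: "h > 0" using eps_pos[of n] s M by (simp add: h_def)
        have sq: "sqrt (\<epsilon> n) > 0" using eps_pos[of n] by simp
        have cd: "c < d" "x < c" "d < y" using elim sq by (auto simp: c_def d_def)
        have "\<bar>g n d - g n c\<bar> \<le> \<eta> * (d - c) + B * h"
        proof (rule increment_le_of_windows[OF h _ B])
          show "\<bar>g n (t + h) - g n t\<bar> \<le> \<eta> * h" if "c \<le> t" "t + h \<le> d" for t
          proof -
            have "\<bar>e n (t + \<epsilon> n * s * M) - e n t - \<kappa> * (\<epsilon> n * s * M)\<bar> \<le> \<eta> * (\<epsilon> n * s * M)"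
            proof (rule win)
              show "\<bar>t - x0\<bar> < \<delta>" using that h cd x(2) y(2) by (auto simp: abs_less_iff)
              show "sqrt (\<epsilon> n) \<le> t" using that x by (auto simp: c_def)
              show "t \<le> 1 - sqrt (\<epsilon> n)" using that h y by (auto simp: d_def)
            qed (use elim in simp)
            then show ?thesis by (simp add: g_def h_def algebra_simps)
          qed
          show "\<bar>g n t' - g n t\<bar> \<le> B * (t' - t)" if "c \<le> t" "t \<le> t'" "t' \<le> d" for t t'
            by (rule g_lip) (use that cd x y in auto)
        qed (use cd \<eta> in auto)
        moreover have "\<eta> * (d - c) \<le> \<eta> * (y - x)"
          using cd \<eta> by (intro mult_left_mono) auto
        moreover have "\<bar>g n c - g n x\<bar> \<le> B * sqrt (\<epsilon> n)"
          using g_lip[of x c n] cd x y by (auto simp: c_def)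
        moreover have "\<bar>g n y - g n d\<bar> \<le> B * sqrt (\<epsilon> n)"
          using g_lip[of d y n] cd x y by (auto simp: d_def)
        ultimately show ?case by (simp add: h_def)
      qed
      moreover have "(\<lambda>n. \<bar>g n y - g n x\<bar>) \<longlonglongrightarrow> \<bar>(E y - \<kappa> * y) - (E x - \<kappa> * x)\<bar>"
        unfolding g_def by (intro tendsto_intros e_tendsto x y)
      moreover have "(\<lambda>n. \<eta> * (y - x) + B * (\<epsilon> n * s * M) + 2 * B * sqrt (\<epsilon> n))
          \<longlonglongrightarrow> \<eta> * (y - x) + B * (0 * s * M) + 2 * B * sqrt 0"
        by (intro tendsto_intros eps_lim)
      ultimately have "\<bar>(E y - \<kappa> * y) - (E x - \<kappa> * x)\<bar> \<le> \<eta> * (y - x) + B * (0 * s * M) + 2 * B * sqrt 0"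
        by (intro tendsto_le[OF sequentially_bot])
      then show ?thesis by (simp add: algebra_simps)
    qed
    with \<delta> show ?thesis by blast
  qed
  have "((\<lambda>y. (E y - E x0) / (y - x0)) \<longlongrightarrow> \<kappa>) (at x0 within {0..1})"
  proof (rule tendstoI)
    fix \<eta> :: real assume \<eta>: "\<eta> > 0"
    then have "\<eta> / 2 > 0" by simp
    from key[OF this] obtain \<delta> where \<delta>: "\<delta> > 0" "\<And>x y. x \<in> {0..1} \<Longrightarrow> y \<in> {0..1} \<Longrightarrow> x < y \<Longrightarrow>
        \<bar>x - x0\<bar> < \<delta> \<Longrightarrow> \<bar>y - x0\<bar> < \<delta> \<Longrightarrow> \<bar>E y - E x - \<kappa> * (y - x)\<bar> \<le> \<eta> / 2 * (y - x)"
      by metis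
    have "dist ((E y - E x0) / (y - x0)) \<kappa> < \<eta>" if y: "y \<in> {0..1}" "y \<noteq> x0" "dist y x0 < \<delta>" for y
    proof -
      have "\<bar>E y - E x0 - \<kappa> * (y - x0)\<bar> \<le> \<eta> / 2 * \<bar>y - x0\<bar>"
      proof (cases "x0 < y")
        case True
        then show ?thesis using \<delta>(2)[OF x0 y(1)] y \<delta>(1) by (simp add: dist_real_def)
      next
        case False
        then have "\<bar>E x0 - E y - \<kappa> * (x0 - y)\<bar> \<le> \<eta> / 2 * (x0 - y)"
          using \<delta>(2)[OF y(1) x0] y \<delta>(1) by (simp add: dist_real_def)
        moreover have "E y - E x0 - \<kappa> * (y - x0) = - (E x0 - E y - \<kappa> * (x0 - y))"
          by (simp add: algebra_simps)
        ultimately show ?thesis using False by (metis abs_minus_cancel abs_minus_commute abs_of_nonneg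
              diff_ge_0_iff_ge not_less)
      qed
      then have "\<bar>E y - E x0 - \<kappa> * (y - x0)\<bar> / \<bar>y - x0\<bar> \<le> \<eta> / 2"
        using y by (simp add: field_simps)
      moreover have "(E y - E x0) / (y - x0) - \<kappa> = (E y - E x0 - \<kappa> * (y - x0)) / (y - x0)"
        using y by (simp add: field_simps)
      then have "dist ((E y - E x0) / (y - x0)) \<kappa> = \<bar>E y - E x0 - \<kappa> * (y - x0)\<bar> / \<bar>y - x0\<bar>"
        by (simp only: dist_real_def abs_divide)
      ultimately show ?thesis using \<eta> by linarith
    qed
    then show "\<forall>\<^sub>F y in at x0 within {0..1}. dist ((E y - E x0) / (y - x0)) \<kappa> < \<eta>"
      using \<delta>(1) by (auto simp: eventually_at)
  qed
  then show ?thesis by (simp add: has_field_derivative_iff \<kappa>_def)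
qed

theorem theorem3p5:
  fixes p C_m1 C_0 C_1 W0 :: real
    and a W E :: "real \<Rightarrow> real"
    and \<epsilon> :: "nat \<Rightarrow> real"
    and u :: "nat \<Rightarrow> real \<Rightarrow> real"
  assumes "p > 1"
    and "C1_on {0..1} a" and "\<forall>x\<in>{0..1}. a x > 0"
    and "C1_on {-1..1} W"
    and "C_m1 > 0" and "C_0 > 0" and "C_1 > 0" and "W0 > 0"
    and "(\<lambda>s. W s - C_m1 / p * \<bar>s - (-1)\<bar> powr p)
           \<in> o[at (-1) within {-1..1}](\<lambda>s. \<bar>s - (-1)\<bar> powr p)"
    and "(\<lambda>s. W s - C_1 / p * \<bar>s - 1\<bar> powr p)
           \<in> o[at 1 within {-1..1}](\<lambda>s. \<bar>s - 1\<bar> powr p)"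
    and "(\<lambda>s. W s - (W0 - C_0 / p * \<bar>s\<bar> powr p)) \<in> o[at 0](\<lambda>s. \<bar>s\<bar> powr p)"
    and "strict_antimono_on {-1..<0} (\<lambda>s. deriv_on {-1..1} W s / phi p s)"
    and "strict_mono_on {0<..1} (\<lambda>s. deriv_on {-1..1} W s / phi p s)"
    and "filterlim \<epsilon> (at_right 0) sequentially"
    and "\<forall>n. bvp_solution p a W (\<epsilon> n) (u n)"
    and "uniform_limit {0..1} (\<lambda>n. energy p a W (\<epsilon> n) (u n)) E sequentially"
  shows "\<forall>x\<in>{0..1}. E x \<in> {0..W0} \<and>
           (E has_real_derivative deriv_on {0..1} a x / a x * K p W W0 (E x))
             (at x within {0..1})"
proof -
  note p = assms(1)
  define D where "D = deriv_on {-1..1} W"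
  have W_deriv: "(W has_real_derivative D x) (at x within {-1..1})" if "x \<in> {-1..1}" for x
    unfolding D_def using C1_on_has_deriv_on[OF assms(4) that] .
  have D_cont: "continuous_on {-1..1} D" using assms(4) by (simp add: C1_on_def D_def)
  have W_cont: "continuous_on {-1..1} W"
    using W_deriv by (meson DERIV_continuous continuous_on_eq_continuous_within)
  have nt: "at (c::real) within {-1..1} \<noteq> bot" if "c \<in> {-1..1}" for c
    using that islimpt_Icc[of "-1" 1 c] by (simp add: trivial_limit_within)
  have W_lim: "(W \<longlongrightarrow> W c) (at c within {-1..1})" if "c \<in> {-1..1}" for c
    using W_cont that by (simp add: continuous_on_def)
  note right = eventually_le_of_smallo_power[OF assms(10)]
  note left = eventually_le_of_smallo_power[OF assms(9)]
  have W1: "W 1 = 0" by (rule zero_of_le_power[OF right]) (use p W_lim nt in auto)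
  have Wm1: "W (-1) = 0" by (rule zero_of_le_power[OF left]) (use p W_lim nt in auto)
  \<comment> \<open>with the monotonicity of \<open>W' / \<phi>\<^sub>p\<close>, the vanishing of \<open>W'\<close> at the wells fixes its sign in between\<close>
  have D1: "D 1 = 0"
    by (rule deriv_zero_of_le_power[OF right p W_deriv nt W1]) auto
  have Dm1: "D (-1) = 0"
    by (rule deriv_zero_of_le_power[OF left p W_deriv nt Wm1]) auto
  have W_0: "W 0 = W0"
  proof -
    have "\<forall>\<^sub>F s in at 0. \<bar>W s - W0\<bar> \<le> (\<bar>- C_0 / p\<bar> + 1) * \<bar>s - 0\<bar> powr p"
      by (rule eventually_le_of_smallo_power) (use assms(11) in \<open>simp add: algebra_simps\<close>)
    then have "W 0 - W0 = 0"
    proof (rule zero_of_le_power)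
      have "(W \<longlongrightarrow> W 0) (at 0)" using W_lim[of 0] by (simp add: at_within_Icc_at)
      then show "((\<lambda>s. W s - W0) \<longlongrightarrow> W 0 - W0) (at 0)" by (intro tendsto_intros)
    qed (use p in auto)
    then show ?thesis by simp
  qed
  obtain Wmax where Wmax: "\<And>s. s \<in> {-1..1} \<Longrightarrow> W s \<le> Wmax"
  proof -
    have "\<exists>x\<in>{-1..1}. \<forall>y\<in>{-1..1}. W y \<le> W x"
      by (rule continuous_attains_sup) (use W_cont in auto)
    then show thesis using that by blast
  qed
  obtain Cr where Cr: "Cr \<ge> 0" "\<And>s. s \<in> {-1..1} \<Longrightarrow> W s \<le> Cr * \<bar>s - 1\<bar> powr p"
    by (rule ex_global_power_bound[OF right _ _ W1 Wmax]) (use p in auto)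
  obtain Cl where Cl: "Cl \<ge> 0" "\<And>s. s \<in> {-1..1} \<Longrightarrow> W s \<le> Cl * \<bar>s - (-1)\<bar> powr p"
    by (rule ex_global_power_bound[OF left _ _ Wm1 Wmax]) (use p in auto)
  define C where "C = Cr + Cl"
  interpret well: double_well p W D W0 C
  proof
    show "D x < 0" if "0 < x" "x < 1" for x
    proof -
      have "D x / phi p x < D 1 / phi p 1"
        using monotone_onD[OF assms(13), of x 1] that by (auto simp: D_def)
      then show ?thesis using that D1 by (simp add: divide_less_0_iff not_less)
    qed
    show "D x > 0" if "-1 < x" "x < 0" for x
    proof -
      have "D x / phi p x < D (-1) / phi p (-1)"
        using monotone_onD[OF assms(12), of "-1" x] that by (auto simp: D_def)
      then show ?thesis using that Dm1 phi_neg_iff[of p x] by (auto simp: divide_less_0_iff)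
    qed
    fix x :: real assume x: "x \<in> {-1..1}"
    have "W x \<le> Cr * \<bar>x - 1\<bar> powr p" by (rule Cr(2)[OF x])
    also have "\<dots> \<le> C * (1 - x) powr p"
      using x Cr(1) Cl(1) by (auto simp: C_def intro!: mult_mono)
    finally show "W x \<le> C * (1 - x) powr p" .
    have "W x \<le> Cl * \<bar>x - (-1)\<bar> powr p" by (rule Cl(2)[OF x])
    also have "\<dots> \<le> C * (1 + x) powr p"
      using x Cr(1) Cl(1) by (auto simp: C_def add.commute intro!: mult_mono)
    finally show "W x \<le> C * (1 + x) powr p" .
  qed (use p W_deriv D_cont W_0 W1 Wm1 in auto)

  define da where "da = deriv_on {0..1} a"
  have a_deriv: "(a has_real_derivative da x) (at x within {0..1})" if "x \<in> {0..1}" for x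
    unfolding da_def using C1_on_has_deriv_on[OF assms(2) that] .
  have a_cont: "continuous_on {0..1} a"
    using a_deriv by (meson DERIV_continuous continuous_on_eq_continuous_within)
  have sol: "bvp_solution p a W (\<epsilon> n) (u n)" for n using assms(15) by blast
  have u_C1: "C1_on {0..1} (u n)" and flux_C1: "C1_on {0..1} (\<lambda>x. phi p (deriv_on {0..1} (u n) x))"
    and u_ran: "u n ` {0..1} \<subseteq> {-1..1}" for n
    using sol[of n] by (auto simp: bvp_solution_def)
  have u_range: "u n x \<in> {-1..1}" if "x \<in> {0..1}" for n x using u_ran that by blast
  have u_cont: "continuous_on {0..1} (u n)" for n
    using u_C1[of n] by (auto simp: C1_on_def intro: differentiable_imp_continuous_on)
  have energy_cont: "continuous_on {0..1} (energy p a W (\<epsilon> n) (u n))" for n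
  proof -
    have "continuous_on {0..1} (deriv_on {0..1} (u n))" using u_C1[of n] by (simp add: C1_on_def)
    then show ?thesis
      unfolding energy_def[abs_def] using assms(3) u_range
      by (intro continuous_intros p a_cont continuous_on_compose2[OF W_cont u_cont]) force+
  qed
  have "continuous_on {0..1} E"
    by (rule uniform_limit_theorem[OF _ assms(16)]) (auto intro: always_eventually energy_cont)
  then obtain B where B: "\<And>x. x \<in> {0..1} \<Longrightarrow> \<bar>E x\<bar> \<le> B"
    using bounded_of_continuous by blast
  have "\<forall>\<^sub>F n in sequentially. \<epsilon> n > 0"
    using assms(14) by (auto simp: filterlim_at elim: eventually_mono)
  moreover have "\<forall>\<^sub>F n in sequentially. \<forall>x\<in>{0..1}. dist (energy p a W (\<epsilon> n) (u n) x) (E x) < 1"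
    using assms(16) by (simp add: uniform_limit_iff)
  ultimately have "\<forall>\<^sub>F n in sequentially. \<epsilon> n > 0 \<and>
      (\<forall>x\<in>{0..1}. dist (energy p a W (\<epsilon> n) (u n) x) (E x) < 1)"
    by (rule eventually_conj)
  then obtain N where N: "\<And>n. n \<ge> N \<Longrightarrow> \<epsilon> n > 0"
    "\<And>n x. n \<ge> N \<Longrightarrow> x \<in> {0..1} \<Longrightarrow> dist (energy p a W (\<epsilon> n) (u n) x) (E x) < 1"
    unfolding eventually_sequentially by blast
  have shift: "filterlim (\<lambda>n. n + N) at_top sequentially"
    by (rule filterlim_add_const_nat_at_top)
  \<comment> \<open>the tail of the sequence, along which \<open>\<epsilon>\<^sub>n > 0\<close> and the energies are within \<open>1\<close> of their limit\<close>
  interpret singular_family p W D W0 C a da "\<lambda>n. \<epsilon> (n + N)" "\<lambda>n. u (n + N)"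
    "\<lambda>n x. phi p (\<epsilon> (n + N) * deriv_on {0..1} (u (n + N)) x)"
    "\<lambda>n. energy p a W (\<epsilon> (n + N)) (u (n + N))" E "B + 1"
  proof
    fix n :: nat and x :: real
    define m where "m = n + N"
    have \<epsilon>m: "\<epsilon> m > 0" using N by (simp add: m_def)
    show "\<epsilon> (n + N) > 0" using \<epsilon>m by (simp add: m_def)
    show "energy p a W (\<epsilon> (n + N)) (u (n + N)) x = W (u (n + N) x) -
        kin p (phi (conj_exp p) (phi p (\<epsilon> (n + N) * deriv_on {0..1} (u (n + N)) x))) / a x"
      using p by (simp add: energy_def)
    assume x: "x \<in> {0..1}"
    show "u (n + N) x \<in> {-1..1}" by (rule u_range[OF x])
    have "(u m has_real_derivative deriv_on {0..1} (u m) x) (at x within {0..1})"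
      by (rule C1_on_has_deriv_on[OF u_C1 x])
    then show "(u (n + N) has_real_derivative phi (conj_exp p) (phi p (\<epsilon> (n + N) *
        deriv_on {0..1} (u (n + N)) x)) / \<epsilon> (n + N)) (at x within {0..1})"
      using p \<epsilon>m by (simp add: m_def)
    define flux where "flux y = phi p (\<epsilon> m * deriv_on {0..1} (u m) y)" for y
    have "flux = (\<lambda>y. \<epsilon> m powr (p - 1) * phi p (deriv_on {0..1} (u m) y))"
      using phi_scale[OF \<epsilon>m] by (auto simp: flux_def)
    then have "flux differentiable_on {0..1}"
      using flux_C1[of m] by (auto simp: C1_on_def intro!: differentiable_on_mult)
    from differentiable_on_has_deriv_on[OF this x]
    have "(flux has_real_derivative deriv_on {0..1} flux x) (at x within {0..1})" .
    moreover have "- (\<epsilon> m * deriv_on {0..1} flux x) + a x * D (u m x) = 0"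
      using sol[of m] x by (simp add: bvp_solution_def D_def flux_def[abs_def])
    then have "deriv_on {0..1} flux x = a x * D (u m x) / \<epsilon> m"
      using \<epsilon>m by (simp add: field_simps)
    ultimately show "((\<lambda>x. phi p (\<epsilon> (n + N) * deriv_on {0..1} (u (n + N)) x)) has_real_derivative
        a x * D (u (n + N) x) / \<epsilon> (n + N)) (at x within {0..1})"
      by (simp add: flux_def[abs_def] m_def)
    show "\<bar>energy p a W (\<epsilon> (n + N)) (u (n + N)) x\<bar> \<le> B + 1"
      using N(2)[of "n + N" x] B[OF x] x by (simp add: dist_real_def)
  next
    have "\<epsilon> \<longlonglongrightarrow> 0" using assms(14) by (simp add: filterlim_at)
    from filterlim_compose[OF this shift] show "(\<lambda>n. \<epsilon> (n + N)) \<longlonglongrightarrow> 0" .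
    show "uniform_limit {0..1} (\<lambda>n. energy p a W (\<epsilon> (n + N)) (u (n + N))) E sequentially"
      using filterlim_compose[OF assms(16) shift] .
  qed (use a_deriv assms(2,3) in \<open>auto simp: C1_on_def da_def\<close>)
  show ?thesis
    using limit_energy_range limit_energy_deriv by (auto simp: da_def)
qed

end
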